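(* Let $F$ be a field with at least four elements and let $R$ be a finite dimensional $F$-algebra. If $G$ is a subnormal subgroup of $R^*$, then the unipotent radical $\mathfrak{u}(G)$ exists and $\mathfrak{u}(G)=G\cap(1+J(R))$. In particular, $\mathfrak{u}(R^* )=1+J(R)$.
   Context: Algebras are associative and unital. $R^*$ is the unit group of $R$ and $J(R)$ is the Jacobson radical of $R$. An element $x\in R$ is unipotent if $1-x$ is nilpotent. A subgroup of $R^*$ is a unipotent group if each of its elements is unipotent. If a subgroup $G$ of $R^*$ has a unique maximal unipotent normal subgroup (a unipotent normal subgroup of $G$ that is maximal under inclusion among such subgroups), it is denoted $\mathfrak{u}(G)$ and called the unipotent radical of $G$. *)

theory Defs
  imports "HOL-Algebra.Algebra" "Jordan_Normal_Form.Missing_VectorSpace"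
begin

text \<open>The locale \<^locale>\<open>algebra\<close> of HOL-Algebra requires the algebra to be commutative, so
  finite-dimensional associative unital algebras over a field are introduced here. The zero
  algebra is allowed.\<close>

locale finite_dimensional_algebra = vectorspace F R + alg?: ring R
  for F :: "('f, 'm) ring_scheme" and R :: "('f, 'r, 'n) module_scheme" (structure) +
  assumes smult_mult_left:
      "\<lbrakk>a \<in> carrier F; x \<in> carrier R; y \<in> carrier R\<rbrakk> \<Longrightarrow> (a \<odot> x) \<otimes> y = a \<odot> (x \<otimes> y)"
    and smult_mult_right:
      "\<lbrakk>a \<in> carrier F; x \<in> carrier R; y \<in> carrier R\<rbrakk> \<Longrightarrow> x \<otimes> (a \<odot> y) = a \<odot> (x \<otimes> y)"
    and finite_dimensional: "fin_dim"

locale left_ideal = additive_subgroup I R + ring R for I and R (structure) +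
  assumes I_l_closed: "\<lbrakk>a \<in> I; x \<in> carrier R\<rbrakk> \<Longrightarrow> x \<otimes> a \<in> I"

definition maximal_left_ideal :: "'a set \<Rightarrow> ('a, 'b) ring_scheme \<Rightarrow> bool" where
  "maximal_left_ideal I R \<longleftrightarrow> maximal I (\<lambda>K. left_ideal K R \<and> K \<noteq> carrier R)"

text \<open>The intersection is taken inside the carrier, so that the zero ring, which has no maximal
  left ideal, is its own radical.\<close>

definition jacobson_radical :: "('a, 'b) ring_scheme \<Rightarrow> 'a set" where
  "jacobson_radical R = {x \<in> carrier R. \<forall>I. maximal_left_ideal I R \<longrightarrow> x \<in> I}"

definition nilpotent_elem :: "('a, 'b) ring_scheme \<Rightarrow> 'a \<Rightarrow> bool" where
  "nilpotent_elem R x \<longleftrightarrow> x \<in> carrier R \<and> (\<exists>n::nat. x [^]\<^bsub>R\<^esub> n = \<zero>\<^bsub>R\<^esub>)"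

definition unipotent_elem :: "('a, 'b) ring_scheme \<Rightarrow> 'a \<Rightarrow> bool" where
  "unipotent_elem R x \<longleftrightarrow> x \<in> carrier R \<and> nilpotent_elem R (\<one>\<^bsub>R\<^esub> \<ominus>\<^bsub>R\<^esub> x)"

definition unipotent_group :: "('a, 'b) ring_scheme \<Rightarrow> 'a set \<Rightarrow> bool" where
  "unipotent_group R H \<longleftrightarrow> subgroup H (units_of R) \<and> (\<forall>x\<in>H. unipotent_elem R x)"

definition subnormal :: "'a set \<Rightarrow> ('a, 'b) monoid_scheme \<Rightarrow> bool" where
  "subnormal H G \<longleftrightarrow>
     (\<exists>(n::nat) N. N 0 = carrier G \<and> N n = H \<and> (\<forall>i<n. N (Suc i) \<lhd> G\<lparr>carrier := N i\<rparr>))"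

definition unipotent_normal_subgroup ::
    "('a, 'b) ring_scheme \<Rightarrow> 'a set \<Rightarrow> 'a set \<Rightarrow> bool" where
  "unipotent_normal_subgroup R G U \<longleftrightarrow>
     U \<lhd> (units_of R)\<lparr>carrier := G\<rparr> \<and> unipotent_group R U"

definition maximal_unipotent_normal_subgroup ::
    "('a, 'b) ring_scheme \<Rightarrow> 'a set \<Rightarrow> 'a set \<Rightarrow> bool" where
  "maximal_unipotent_normal_subgroup R G U \<longleftrightarrow> maximal U (unipotent_normal_subgroup R G)"

definition has_unipotent_radical :: "('a, 'b) ring_scheme \<Rightarrow> 'a set \<Rightarrow> bool" where
  "has_unipotent_radical R G \<longleftrightarrow> (\<exists>!U. maximal_unipotent_normal_subgroup R G U)"

text \<open>Only meaningful under \<open>has_unipotent_radical R G\<close>.\<close>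

definition unipotent_radical :: "('a, 'b) ring_scheme \<Rightarrow> 'a set \<Rightarrow> 'a set" where
  "unipotent_radical R G = (THE U. maximal_unipotent_normal_subgroup R G U)"

end

theory Submission
  imports Defs
begin

text \<open>Let \<open>J\<close> be the Jacobson radical. The group \<open>G \<inter> (1 + J)\<close> is a unipotent normal subgroup
  of \<open>G\<close>, because \<open>J\<close> is a nil ideal. So everything rests on one inclusion: a unipotent group
  \<open>U\<close> that is subnormal in the unit group lies in \<open>1 + J\<close> (lemma \<open>subnormal_unipotent_subset\<close>).
  Applied to the unipotent normal subgroups of \<open>G\<close>, it makes \<open>G \<inter> (1 + J)\<close> the greatest of them.

  Finite dimension enters through chains of subspaces: for every \<open>x\<close> there are \<open>k\<close> and an element
  \<open>g\<close> commuting with \<open>x\<close> such that \<open>x\<^sup>k = g x\<^sup>k\<^sup>+\<^sup>1\<close>. Hence \<open>J\<close> is nil, and every nonzero left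
  ideal of \<open>S = R/J\<close> contains a nonzero idempotent.

  Suppose that \<open>U\<close> contains an element whose image \<open>u = 1 + a\<close> in \<open>S\<close> has \<open>a \<noteq> 0\<close>, and let
  \<open>p\<close> be the largest exponent with \<open>a\<^sup>p \<noteq> 0\<close>. An idempotent in \<open>S a\<^sup>p\<close> gives \<open>r \<noteq> 0\<close> with
  \<open>r a\<^sup>p r = r\<close> and \<open>r a\<^sup>s r = 0\<close> for \<open>s < p\<close> (lemma \<open>normalized_quasi_inverse\<close>). The
  elements \<open>a\<^sup>p\<^sup>-\<^sup>i r a\<^sup>j\<close> with \<open>0 \<le> i, j \<le> p\<close> are then matrix units, and \<open>a\<close> acts on them as a
  nilpotent Jordan block of size \<open>p + 1 \<ge> 2\<close>.

  The subnormal chain is descended with a set \<open>T\<close> of units such that every group of units that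
  contains \<open>u\<close> and is normalized by \<open>T\<close> contains \<open>T\<close>. If \<open>T\<close> lies in one term of the chain, then
  it normalizes the next term, and \<open>u\<close> belongs to that term, so \<open>T\<close> lies in it too. In the end
  \<open>T\<close> lies in the image of \<open>U\<close>. If \<open>p \<ge> 2\<close>, let \<open>T\<close> consist of the transvections on three of the
  indices: \<open>u\<close> and one transvection have another transvection as commutator, and the commutators
  of that one with \<open>T\<close> produce the rest. If \<open>p = 1\<close>, one unit \<open>t\<close> with the braid relation
  \<open>u t u = t u t\<close> suffices, since then \<open>t = u (t u t\<^sup>-\<^sup>1) u\<^sup>-\<^sup>1\<close>. In both cases the image of \<open>U\<close>
  contains a product of two opposite transvections. On a two-dimensional block this product has
  trace 3 and determinant 1, which is impossible for a unipotent element (lemma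
  \<open>golden_product_not_unipotent\<close>).\<close>

section \<open>Strongly \<pi>-regular rings\<close>

text \<open>A vector in each difference \<open>W i - W (i + 1)\<close>, chosen from the bottom of the chain upwards, lies
  outside the span of the vectors chosen before it.\<close>

lemma (in vectorspace) strict_chain_lin_indpt:
  assumes "\<And>i. i \<le> n \<Longrightarrow> submodule K (W i) V"
    and "\<And>i. i < n \<Longrightarrow> W (Suc i) \<subset> W i"
  shows "\<exists>A. finite A \<and> card A = n \<and> A \<subseteq> W 0 \<and> lin_indpt A"
  using assms
proof (induction n arbitrary: W)
  case 0
  have "lin_indpt {}" unfolding lin_dep_def by auto
  then show ?case by (intro exI[of _ "{}"]) auto
next
  case (Suc n)
  have "\<exists>A. finite A \<and> card A = n \<and> A \<subseteq> W (Suc 0) \<and> lin_indpt A"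
    using Suc.prems by (intro Suc.IH[of "\<lambda>i. W (Suc i)"]) simp_all
  then obtain A where A: "finite A" "card A = n" "A \<subseteq> W (Suc 0)" "lin_indpt A"
    by blast
  have "W (Suc 0) \<subset> W 0" using Suc.prems(2) by blast
  then obtain v where v: "v \<in> W 0" "v \<notin> W (Suc 0)" "W (Suc 0) \<subseteq> W 0" by blast
  interpret W0: submodule K "W 0" V using Suc.prems(1) by blast
  interpret W1: submodule K "W (Suc 0)" V using Suc.prems(1) by simp
  have Ac: "A \<subseteq> carrier V" using A(3) W1.subset by blast
  have "span A \<subseteq> W (Suc 0)"
    using span_is_subset[OF A(3)] W1.submodule_axioms by blast
  with v(2) have "v \<notin> span A" by blast
  moreover have "v \<notin> A" using v(2) A(3) by blast
  ultimately have "lin_indpt (insert v A)"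
    using lin_dep_iff_in_span[of A v] Ac A(4) v(1) W0.subset by auto
  moreover have "card (insert v A) = Suc n" using A \<open>v \<notin> A\<close> by simp
  ultimately show ?case using A v by (intro exI[of _ "insert v A"]) auto
qed

lemma (in vectorspace) descending_chain_stabilizes:
  assumes "fin_dim"
    and sub: "\<And>i::nat. submodule K (W i) V"
    and desc: "\<And>i. W (Suc i) \<subseteq> W i"
  shows "\<exists>k. W (Suc k) = W k"
proof (rule ccontr)
  assume "\<not> ?thesis"
  with desc have "\<And>i. W (Suc i) \<subset> W i" by blast
  with strict_chain_lin_indpt[of "Suc dim" W] sub obtain A
    where A: "finite A" "card A = Suc dim" "A \<subseteq> W 0" "lin_indpt A" by blast
  interpret W0: submodule K "W 0" V using sub .
  from li_le_dim(2)[OF assms(1) _ A(4)] A W0.subset show False by auto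
qed

locale strongly_pi_regular_ring = ring R for R (structure) +
  assumes strongly_pi_regular:
    "x \<in> carrier R \<Longrightarrow>
      \<exists>(k::nat) g. g \<in> carrier R \<and> g \<otimes> x = x \<otimes> g \<and> x [^] k = g \<otimes> x [^] Suc k"

text \<open>The subspaces \<open>C x\<^sup>k\<close> stabilize, where \<open>C\<close> is the centralizer of \<open>x\<close>. Taking \<open>C\<close> instead of
  the whole algebra is what makes \<open>g\<close> commute with \<open>x\<close>.\<close>

lemma (in finite_dimensional_algebra) strongly_pi_regular_ring: "strongly_pi_regular_ring R"
proof (unfold_locales)
  fix x assume x [simp]: "x \<in> carrier R"
  define C where "C = {y \<in> carrier R. y \<otimes> x = x \<otimes> y}"
  define W where "W k = (\<lambda>y. y \<otimes> x [^] k) ` C" for k :: nat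
  have C_carr: "y \<in> carrier R" if "y \<in> C" for y using that by (simp add: C_def)
  have C0: "\<zero> \<in> C" by (simp add: C_def)
  have C_add: "y \<oplus> z \<in> C" if "y \<in> C" "z \<in> C" for y z
    using that by (simp add: C_def l_distr r_distr)
  have C_smult: "c \<odot> y \<in> C" if "c \<in> carrier F" "y \<in> C" for c y
    using that by (simp add: C_def smult_mult_left smult_mult_right)
  have sub: "submodule F (W k) R" for k
  proof (unfold_locales)
    show "W k \<subseteq> carrier R" by (auto simp: W_def C_carr)
    show "v \<oplus> w \<in> W k" if vw: "v \<in> W k" "w \<in> W k" for v w
    proof -
      obtain y z where "y \<in> C" "z \<in> C" "v = y \<otimes> x [^] k" "w = z \<otimes> x [^] k"
        using vw by (auto simp: W_def)
      then show ?thesis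
        unfolding W_def by (intro image_eqI[of _ _ "y \<oplus> z"]) (auto simp: l_distr C_carr C_add)
    qed
    show "\<zero> \<in> W k"
      unfolding W_def using C0 by (intro image_eqI[of _ _ "\<zero>"]) auto
    show "c \<odot> v \<in> W k" if cv: "c \<in> carrier F" "v \<in> W k" for c v
    proof -
      obtain y where "y \<in> C" "v = y \<otimes> x [^] k"
        using cv(2) by (auto simp: W_def)
      then show ?thesis using cv(1)
        unfolding W_def
        by (intro image_eqI[of _ _ "c \<odot> y"]) (auto simp: smult_mult_left C_carr C_smult)
    qed
  qed
  have pow: "x [^] Suc k = x \<otimes> x [^] k" for k by (simp only: nat_pow_Suc2[OF x])
  have "W (Suc k) \<subseteq> W k" for k
  proof
    fix v assume "v \<in> W (Suc k)"
    then obtain y where y: "y \<in> C" "v = y \<otimes> x [^] Suc k" by (auto simp: W_def)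
    then have "v = (y \<otimes> x) \<otimes> x [^] k" by (simp only: pow) (simp add: C_carr m_assoc)
    moreover have "y \<otimes> x \<in> C" using y(1) by (simp add: C_def m_assoc)
    ultimately show "v \<in> W k" by (auto simp: W_def)
  qed
  from descending_chain_stabilizes[OF finite_dimensional, of W] sub this
  obtain k where "W (Suc k) = W k" by blast
  moreover have "x [^] k \<in> W k"
    unfolding W_def by (intro image_eqI[of _ _ "\<one>"]) (auto simp: C_def)
  ultimately have "x [^] k \<in> W (Suc k)" by simp
  then obtain g where "g \<in> C" "x [^] k = g \<otimes> x [^] Suc k" by (auto simp: W_def)
  then show "\<exists>(k::nat) g. g \<in> carrier R \<and> g \<otimes> x = x \<otimes> g \<and> x [^] k = g \<otimes> x [^] Suc k"
    by (auto simp: C_def)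
qed

section \<open>The Jacobson radical\<close>

lemma (in ring) left_idealI:
  assumes "I \<subseteq> carrier R" "\<zero> \<in> I"
    and "\<And>x y. x \<in> I \<Longrightarrow> y \<in> I \<Longrightarrow> x \<oplus> y \<in> I"
    and "\<And>x y. x \<in> carrier R \<Longrightarrow> y \<in> I \<Longrightarrow> x \<otimes> y \<in> I"
  shows "left_ideal I R"
proof -
  have "\<ominus> x \<in> I" if "x \<in> I" for x
  proof -
    have "\<ominus> x = (\<ominus> \<one>) \<otimes> x" using that assms(1) by (auto simp: l_minus)
    then show ?thesis using assms(4)[OF _ that, of "\<ominus> \<one>"] by simp
  qed
  then have "subgroup I (add_monoid R)"
    using assms by (intro add.subgroupI) (auto simp: a_inv_def)
  then show ?thesis
    using assms ring_axioms
    by (intro left_ideal.intro left_ideal_axioms.intro additive_subgroup.intro) auto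
qed

lemma (in ring) left_ideal_one_imp_carrier:
  assumes "left_ideal I R" "\<one> \<in> I"
  shows "I = carrier R"
proof -
  interpret left_ideal I R by fact
  show ?thesis using I_l_closed[OF assms(2)] a_subset by force
qed

text \<open>A left ideal is proper exactly if it omits \<open>1\<close>, and this property passes to unions of chains, so
  Zorn's lemma applies.\<close>

lemma (in ring) proper_left_ideal_in_maximal:
  assumes "left_ideal I R" "I \<noteq> carrier R"
  shows "\<exists>M. maximal_left_ideal M R \<and> I \<subseteq> M"
proof -
  define A where "A = {K. left_ideal K R \<and> K \<noteq> carrier R \<and> I \<subseteq> K}"
  have "\<exists>N\<in>A. \<forall>K\<in>A. N \<subseteq> K \<longrightarrow> K = N"
  proof (rule subset_Zorn_nonempty)
    show "A \<noteq> {}" using assms by (auto simp: A_def)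
    fix C assume C: "C \<noteq> {}" "subset.chain A C"
    then have CA: "C \<subseteq> A" and lin: "\<And>K L. K \<in> C \<Longrightarrow> L \<in> C \<Longrightarrow> K \<subseteq> L \<or> L \<subseteq> K"
      by (auto simp: subset_chain_def)
    have li: "left_ideal K R" if "K \<in> C" for K using that CA by (auto simp: A_def)
    have ag: "additive_subgroup K R" if "K \<in> C" for K using li[OF that] by (simp add: left_ideal_def)
    have "left_ideal (\<Union> C) R"
    proof (rule left_idealI)
      show "\<Union> C \<subseteq> carrier R" using additive_subgroup.a_subset[OF ag] by blast
      show "\<zero> \<in> \<Union> C" using C(1) additive_subgroup.zero_closed[OF ag] by blast
      show "x \<oplus> y \<in> \<Union> C" if xy: "x \<in> \<Union> C" "y \<in> \<Union> C" for x y
      proof -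
        from xy obtain K L where "K \<in> C" "L \<in> C" "x \<in> K" "y \<in> L" by blast
        with lin obtain Z where "Z \<in> C" "x \<in> Z" "y \<in> Z" by blast
        then show ?thesis using additive_subgroup.a_closed[OF ag] by blast
      qed
      show "x \<otimes> y \<in> \<Union> C" if "x \<in> carrier R" "y \<in> \<Union> C" for x y
        using that left_ideal.I_l_closed[OF li] by blast
    qed
    moreover have "\<one> \<notin> \<Union> C"
      using CA left_ideal_one_imp_carrier by (auto simp: A_def)
    moreover have "I \<subseteq> \<Union> C" using C(1) CA by (auto simp: A_def)
    ultimately show "\<Union> C \<in> A" by (auto simp: A_def)
  qed
  then obtain N where N: "N \<in> A" and max: "\<And>K. K \<in> A \<Longrightarrow> N \<subseteq> K \<Longrightarrow> K = N" by blast
  have "maximal_left_ideal N R"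
    unfolding maximal_left_ideal_def maximal_def
  proof (intro conjI allI impI)
    show "left_ideal N R" "N \<noteq> carrier R" using N by (auto simp: A_def)
    fix B assume B: "N \<subseteq> B \<and> left_ideal B R \<and> B \<noteq> carrier R"
    then have "B \<in> A" using N by (auto simp: A_def)
    then show "B = N" using B max by blast
  qed
  then show ?thesis using N by (auto simp: A_def)
qed

text \<open>Otherwise \<open>1 - x\<close> would generate a proper left ideal. A maximal left ideal above it would contain
  \<open>x\<close>, and so \<open>1\<close>.\<close>

lemma (in ring) jacobson_radical_left_inverse:
  assumes x: "x \<in> jacobson_radical R"
  shows "\<exists>y \<in> carrier R. y \<otimes> (\<one> \<ominus> x) = \<one>"
proof (rule ccontr)
  assume no: "\<not> ?thesis"
  have xR [simp]: "x \<in> carrier R" using x by (simp add: jacobson_radical_def)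
  let ?I = "(\<lambda>y. y \<otimes> (\<one> \<ominus> x)) ` carrier R"
  have "left_ideal ?I R"
  proof (rule left_idealI)
    show "\<zero> \<in> ?I" by (intro image_eqI[of _ _ "\<zero>"]) auto
    show "u \<oplus> v \<in> ?I" if uv: "u \<in> ?I" "v \<in> ?I" for u v
    proof -
      obtain y z where "y \<in> carrier R" "z \<in> carrier R" "u = y \<otimes> (\<one> \<ominus> x)" "v = z \<otimes> (\<one> \<ominus> x)"
        using uv by auto
      then show ?thesis by (intro image_eqI[of _ _ "y \<oplus> z"]) (auto simp: l_distr)
    qed
    show "u \<otimes> v \<in> ?I" if uv: "u \<in> carrier R" "v \<in> ?I" for u v
    proof -
      obtain z where "z \<in> carrier R" "v = z \<otimes> (\<one> \<ominus> x)" using uv by auto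
      then show ?thesis using uv(1) by (intro image_eqI[of _ _ "u \<otimes> z"]) (auto simp: m_assoc)
    qed
  qed auto
  moreover have "\<one> \<notin> ?I" using no by auto
  ultimately obtain M where M: "maximal_left_ideal M R" "?I \<subseteq> M"
    using proper_left_ideal_in_maximal by blast
  then have Ml: "left_ideal M R" "M \<noteq> carrier R"
    by (auto simp: maximal_left_ideal_def maximal_def)
  interpret M: left_ideal M R by fact
  have "x \<in> M" using x M(1) by (auto simp: jacobson_radical_def)
  moreover have "\<one> \<otimes> (\<one> \<ominus> x) \<in> M" using M(2) by blast
  ultimately have "(\<one> \<ominus> x) \<oplus> x \<in> M" using M.a_closed by simp
  moreover have "(\<one> \<ominus> x) \<oplus> x = \<one>" using xR by algebra
  ultimately show False using left_ideal_one_imp_carrier[OF Ml(1)] Ml(2) by simp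
qed

lemma (in ring) jacobson_radical_left_ideal: "left_ideal (jacobson_radical R) R"
proof (rule left_idealI)
  have li: "left_ideal M R" if "maximal_left_ideal M R" for M
    using that by (auto simp: maximal_left_ideal_def maximal_def)
  have ag: "additive_subgroup M R" if "maximal_left_ideal M R" for M
    using li[OF that] by (simp add: left_ideal_def)
  show "jacobson_radical R \<subseteq> carrier R" by (auto simp: jacobson_radical_def)
  show "\<zero> \<in> jacobson_radical R"
    using additive_subgroup.zero_closed[OF ag] by (auto simp: jacobson_radical_def)
  show "x \<oplus> y \<in> jacobson_radical R"
    if "x \<in> jacobson_radical R" "y \<in> jacobson_radical R" for x y
    using that additive_subgroup.a_closed[OF ag] by (auto simp: jacobson_radical_def)
  show "x \<otimes> y \<in> jacobson_radical R" if "x \<in> carrier R" "y \<in> jacobson_radical R" for x y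
    using that left_ideal.I_l_closed[OF li] by (auto simp: jacobson_radical_def)
qed

text \<open>The inverse is the geometric series. Its partial sums are built by induction, together with the
  fact that they commute with \<open>1 - x\<close>.\<close>

lemma (in ring) one_minus_nilpotent_Units:
  assumes "nilpotent_elem R x"
  shows "\<one> \<ominus> x \<in> Units R"
proof -
  from assms obtain n :: nat where x [simp]: "x \<in> carrier R" and n: "x [^] n = \<zero>"
    by (auto simp: nilpotent_elem_def)
  have "\<exists>y \<in> carrier R. y \<otimes> (\<one> \<ominus> x) = \<one> \<ominus> x [^] k \<and> (\<one> \<ominus> x) \<otimes> y = \<one> \<ominus> x [^] k" for k :: nat
  proof (induction k)
    case 0
    show ?case by (intro bexI[of _ "\<zero>"]) (auto simp: minus_eq r_neg)
  next
    case (Suc k)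
    then obtain y where y: "y \<in> carrier R" "y \<otimes> (\<one> \<ominus> x) = \<one> \<ominus> x [^] k"
      "(\<one> \<ominus> x) \<otimes> y = \<one> \<ominus> x [^] k" by blast
    have xk: "x [^] k \<in> carrier R" by simp
    have comm: "x \<otimes> x [^] k = x [^] k \<otimes> x" by (simp only: nat_pow_Suc2[OF x, symmetric] nat_pow_Suc)
    have "(y \<oplus> x [^] k) \<otimes> (\<one> \<ominus> x) = (\<one> \<ominus> x [^] k) \<oplus> x [^] k \<otimes> (\<one> \<ominus> x)"
      using y by (simp add: l_distr)
    also have "\<dots> = \<one> \<ominus> x [^] k \<otimes> x"
      using xk x by (simp add: minus_eq r_distr r_minus a_assoc r_neg1)
    finally have 1: "(y \<oplus> x [^] k) \<otimes> (\<one> \<ominus> x) = \<one> \<ominus> x [^] Suc k" by simp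
    have "(\<one> \<ominus> x) \<otimes> (y \<oplus> x [^] k) = (\<one> \<ominus> x [^] k) \<oplus> (\<one> \<ominus> x) \<otimes> x [^] k"
      using y by (simp add: r_distr)
    also have "\<dots> = \<one> \<ominus> x \<otimes> x [^] k"
      using xk x by (simp add: minus_eq l_distr l_minus a_assoc r_neg1)
    finally have 2: "(\<one> \<ominus> x) \<otimes> (y \<oplus> x [^] k) = \<one> \<ominus> x [^] Suc k" by (simp add: comm)
    show ?case using 1 2 y(1) by (intro bexI[of _ "y \<oplus> x [^] k"]) auto
  qed
  from this[of n] n show ?thesis by (auto simp: Units_def minus_eq)
qed

context strongly_pi_regular_ring
begin

text \<open>From \<open>x\<^sup>k = g x\<^sup>k\<^sup>+\<^sup>1\<close> follows \<open>(1 - g x) x\<^sup>k = 0\<close>, and the first factor has a left inverse.\<close>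

lemma jacobson_radical_nil:
  assumes "x \<in> jacobson_radical R"
  shows "nilpotent_elem R x"
proof -
  interpret J: left_ideal "jacobson_radical R" R by (rule jacobson_radical_left_ideal)
  have x [simp]: "x \<in> carrier R" using assms by (rule J.a_Hcarr)
  obtain k :: nat and g where g: "g \<in> carrier R" "g \<otimes> x = x \<otimes> g" "x [^] k = g \<otimes> x [^] Suc k"
    using strongly_pi_regular[OF x] by blast
  obtain y where y: "y \<in> carrier R" "y \<otimes> (\<one> \<ominus> g \<otimes> x) = \<one>"
    using jacobson_radical_left_inverse[OF J.I_l_closed[OF assms g(1)]] by blast
  have "g \<otimes> x [^] Suc k = g \<otimes> x \<otimes> x [^] k"
    using g(1) by (subst nat_pow_Suc2[OF x]) (simp add: m_assoc)
  with g(3) have "g \<otimes> x \<otimes> x [^] k = x [^] k" by (simp only: g(3)[symmetric])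
  then have "(\<one> \<ominus> g \<otimes> x) \<otimes> x [^] k = \<zero>"
    using g(1) by (simp add: minus_eq l_distr l_minus r_neg)
  then have "\<zero> = y \<otimes> ((\<one> \<ominus> g \<otimes> x) \<otimes> x [^] k)" using y(1) by simp
  also have "\<dots> = x [^] k" using y g(1) by (simp add: m_assoc[symmetric])
  finally show ?thesis by (auto simp: nilpotent_elem_def)
qed

text \<open>If a maximal left ideal \<open>M\<close> omits \<open>x\<close>, then \<open>M + R x = R\<close>. So \<open>M\<close> contains some \<open>1 - y x\<close>,
  which is a unit when \<open>y x\<close> is nilpotent.\<close>

lemma jacobson_radicalI:
  assumes x [simp]: "x \<in> carrier R"
    and nil: "\<And>y. y \<in> carrier R \<Longrightarrow> nilpotent_elem R (y \<otimes> x)"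
  shows "x \<in> jacobson_radical R"
proof (rule ccontr)
  assume "\<not> ?thesis"
  then obtain M where M: "maximal_left_ideal M R" "x \<notin> M"
    by (auto simp: jacobson_radical_def)
  then have Ml: "left_ideal M R" "M \<noteq> carrier R"
    and max: "\<And>B. M \<subseteq> B \<Longrightarrow> left_ideal B R \<Longrightarrow> B \<noteq> carrier R \<Longrightarrow> B = M"
    by (auto simp: maximal_left_ideal_def maximal_def)
  interpret M: left_ideal M R by fact
  define B where "B = {i \<oplus> y \<otimes> x | i y. i \<in> M \<and> y \<in> carrier R}"
  have "left_ideal B R"
  proof (rule left_idealI)
    show "B \<subseteq> carrier R" using M.a_subset by (auto simp: B_def)
    have "\<zero> = \<zero> \<oplus> \<zero> \<otimes> x" by simp
    then show "\<zero> \<in> B" using M.zero_closed unfolding B_def by blast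
    show "u \<oplus> v \<in> B" if uv: "u \<in> B" "v \<in> B" for u v
    proof -
      obtain i j y z where *: "i \<in> M" "j \<in> M" "y \<in> carrier R" "z \<in> carrier R"
        "u = i \<oplus> y \<otimes> x" "v = j \<oplus> z \<otimes> x" using uv by (auto simp: B_def)
      then have "i \<in> carrier R" "j \<in> carrier R" using M.a_subset by auto
      then have "u \<oplus> v = (i \<oplus> j) \<oplus> (y \<oplus> z) \<otimes> x" unfolding * using *(3,4) x by algebra
      then show ?thesis using * M.a_closed unfolding B_def by blast
    qed
    show "u \<otimes> v \<in> B" if uv: "u \<in> carrier R" "v \<in> B" for u v
    proof -
      obtain j z where *: "j \<in> M" "z \<in> carrier R" "v = j \<oplus> z \<otimes> x"
        using uv by (auto simp: B_def)
      then have "j \<in> carrier R" using M.a_subset by auto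
      then have "u \<otimes> v = u \<otimes> j \<oplus> (u \<otimes> z) \<otimes> x" unfolding * using *(2) uv(1) x by algebra
      then show ?thesis using * uv(1) M.I_l_closed unfolding B_def by blast
    qed
  qed
  moreover have "M \<subseteq> B"
  proof
    fix i assume i: "i \<in> M"
    then have "i = i \<oplus> \<zero> \<otimes> x" using M.a_subset by auto
    then show "i \<in> B" using i unfolding B_def by blast
  qed
  moreover have "x \<in> B"
  proof -
    have "x = \<zero> \<oplus> \<one> \<otimes> x" by simp
    then show ?thesis using M.zero_closed unfolding B_def by blast
  qed
  ultimately have "B = carrier R" using max M(2) by blast
  then have "\<one> \<in> B" by simp
  then obtain i y where iy: "i \<in> M" "y \<in> carrier R" "\<one> = i \<oplus> y \<otimes> x"
    by (auto simp: B_def)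
  have i: "i \<in> carrier R" using iy(1) M.a_subset by auto
  have "i = (i \<oplus> y \<otimes> x) \<ominus> y \<otimes> x" using i iy(2) x by algebra
  then have "i = \<one> \<ominus> y \<otimes> x" using iy(3) by simp
  then have "i \<in> Units R" using one_minus_nilpotent_Units[OF nil[OF iy(2)]] by simp
  then have "inv i \<otimes> i \<in> M" using iy(1) M.I_l_closed Units_inv_closed by blast
  then have "\<one> \<in> M" using Units_l_inv[OF \<open>i \<in> Units R\<close>] by simp
  then show False using left_ideal_one_imp_carrier Ml by blast
qed

lemma nilpotent_elem_rotate:
  assumes [simp]: "x \<in> carrier R" "y \<in> carrier R" and nil: "nilpotent_elem R (x \<otimes> y)"
  shows "nilpotent_elem R (y \<otimes> x)"
proof -
  obtain n :: nat where n: "(x \<otimes> y) [^] n = \<zero>" using nil by (auto simp: nilpotent_elem_def)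
  have "(y \<otimes> x) [^] Suc k = y \<otimes> (x \<otimes> y) [^] k \<otimes> x" for k :: nat
  proof (induction k)
    case (Suc k)
    have "(y \<otimes> x) [^] Suc (Suc k) = y \<otimes> (x \<otimes> y) [^] k \<otimes> x \<otimes> (y \<otimes> x)"
      using Suc by simp
    also have "\<dots> = y \<otimes> (x \<otimes> y) [^] Suc k \<otimes> x" by (simp add: m_assoc)
    finally show ?case .
  qed simp
  from this[of n] n have "(y \<otimes> x) [^] Suc n = \<zero>" by simp
  then show ?thesis unfolding nilpotent_elem_def by (intro conjI exI[of _ "Suc n"]) auto
qed

text \<open>The radical, defined by left ideals, absorbs right multiplication because
  \<open>y (a x)\<close> is nilpotent as soon as its rotation \<open>(x y) a\<close> is.\<close>

lemma jacobson_radical_ideal: "ideal (jacobson_radical R) R"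
proof -
  interpret J: left_ideal "jacobson_radical R" R by (rule jacobson_radical_left_ideal)
  have *: "a \<otimes> x \<in> jacobson_radical R" if a: "a \<in> jacobson_radical R" and x: "x \<in> carrier R" for a x
  proof (rule jacobson_radicalI)
    have aR: "a \<in> carrier R" using a J.a_subset by blast
    show "a \<otimes> x \<in> carrier R" using aR x by simp
    fix y assume y: "y \<in> carrier R"
    have "nilpotent_elem R ((x \<otimes> y) \<otimes> a)"
      using jacobson_radical_nil J.I_l_closed[OF a] x y by simp
    then have "nilpotent_elem R (x \<otimes> (y \<otimes> a))" using x y aR by (simp add: m_assoc)
    then have "nilpotent_elem R ((y \<otimes> a) \<otimes> x)" using x y aR
      nilpotent_elem_rotate[of x "y \<otimes> a"] by simp
    then show "nilpotent_elem R (y \<otimes> (a \<otimes> x))" using x y aR by (simp add: m_assoc)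
  qed
  show ?thesis by (rule idealI[OF ring_axioms J.a_subgroup J.I_l_closed *])
qed

text \<open>Some multiple \<open>z = y x\<close> is not nilpotent. With \<open>z\<^sup>k = g z\<^sup>k\<^sup>+\<^sup>1\<close>, the element
  \<open>e = g\<^sup>k\<^sup>+\<^sup>1 z\<^sup>k\<^sup>+\<^sup>1\<close> is the Fitting idempotent of \<open>z\<close>: it acts as identity on \<open>z\<^sup>k\<^sup>+\<^sup>1 \<noteq> 0\<close>. Being
  idempotent and nonzero, it is outside the nil ideal. The exponent \<open>k + 1\<close> instead of \<open>k\<close> makes
  it a multiple of \<open>x\<close> even for \<open>k = 0\<close>.\<close>

lemma not_jacobson_radical_idempotent_multiple:
  assumes x [simp]: "x \<in> carrier R" and "x \<notin> jacobson_radical R"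
  shows "\<exists>q \<in> carrier R. q \<otimes> x \<otimes> (q \<otimes> x) = q \<otimes> x \<and> q \<otimes> x \<notin> jacobson_radical R"
proof -
  from assms jacobson_radicalI obtain y where y [simp]: "y \<in> carrier R"
    and "\<not> nilpotent_elem R (y \<otimes> x)" by blast
  define z where "z = y \<otimes> x"
  have z [simp]: "z \<in> carrier R" by (simp add: z_def)
  have nn: "z [^] n \<noteq> \<zero>" for n :: nat
    using \<open>\<not> nilpotent_elem R (y \<otimes> x)\<close> by (auto simp: nilpotent_elem_def z_def)
  obtain k :: nat and g where g [simp]: "g \<in> carrier R" and gz: "g \<otimes> z = z \<otimes> g"
    and k: "z [^] k = g \<otimes> z [^] Suc k"
    using strongly_pi_regular[OF z] by blast
  have gp: "g [^] i \<otimes> z [^] j = z [^] j \<otimes> g [^] i" for i j :: nat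
    using group_commutes_pow[OF group_commutes_pow[OF gz[symmetric] z g, symmetric] g] by simp
  have kj: "z [^] k = g [^] j \<otimes> z [^] (k + j)" for j :: nat
  proof (induction j)
    case (Suc j)
    have "z [^] k = g [^] j \<otimes> (z [^] k \<otimes> z [^] j)"
      using Suc.IH nat_pow_mult[OF z, of k j] by metis
    also have "\<dots> = g [^] j \<otimes> (g \<otimes> z [^] Suc k \<otimes> z [^] j)"
      by (simp only: k[symmetric])
    also have "\<dots> = g [^] Suc j \<otimes> (z [^] Suc k \<otimes> z [^] j)" by (simp add: m_assoc)
    also have "z [^] Suc k \<otimes> z [^] j = z [^] (k + Suc j)"
      by (simp only: nat_pow_mult[OF z] add_Suc add_Suc_right)
    finally show ?case .
  qed simp
  define e where "e = g [^] Suc k \<otimes> z [^] Suc k"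
  have zk1: "z [^] Suc k = e \<otimes> z [^] Suc k"
  proof -
    have "z [^] Suc k = z [^] k \<otimes> z" by simp
    also have "\<dots> = g [^] Suc k \<otimes> z [^] (k + Suc k) \<otimes> z" by (simp only: kj[of "Suc k", symmetric])
    also have "\<dots> = g [^] Suc k \<otimes> z [^] (Suc k + Suc k)" by (simp add: m_assoc)
    also have "\<dots> = e \<otimes> z [^] Suc k"
      unfolding e_def nat_pow_mult[OF z, symmetric] by (rule m_assoc[symmetric]) auto
    finally show ?thesis .
  qed
  have e [simp]: "e \<in> carrier R" by (simp add: e_def)
  have idem: "e \<otimes> e = e"
  proof -
    have "e \<otimes> e = e \<otimes> (z [^] Suc k \<otimes> g [^] Suc k)" unfolding e_def by (simp only: gp)
    also have "\<dots> = (e \<otimes> z [^] Suc k) \<otimes> g [^] Suc k" by (simp add: m_assoc)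
    also have "\<dots> = z [^] Suc k \<otimes> g [^] Suc k" by (simp only: zk1[symmetric])
    also have "\<dots> = e" by (simp only: e_def gp)
    finally show ?thesis .
  qed
  have "e \<notin> jacobson_radical R"
  proof
    assume "e \<in> jacobson_radical R"
    then obtain n :: nat where n: "e [^] n = \<zero>"
      using jacobson_radical_nil by (auto simp: nilpotent_elem_def)
    have "e [^] Suc n = e" for n :: nat by (induction n) (simp_all add: idem)
    with n have "e = \<zero>" by (metis nat_pow_Suc l_null e)
    then have "z [^] Suc k = \<zero>" by (subst zk1) simp
    then show False using nn by blast
  qed
  define q where "q = g [^] Suc k \<otimes> (z [^] k \<otimes> y)"
  have q: "q \<in> carrier R" by (simp add: q_def)
  have "q \<otimes> x = g [^] Suc k \<otimes> (z [^] k \<otimes> y \<otimes> x)"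
    unfolding q_def by (rule m_assoc) auto
  also have "z [^] k \<otimes> y \<otimes> x = z [^] k \<otimes> z" unfolding z_def by (rule m_assoc) auto
  finally have "q \<otimes> x = e" by (simp only: e_def nat_pow_Suc)
  with idem q \<open>e \<notin> jacobson_radical R\<close> show ?thesis by (intro bexI[of _ q]) simp_all
qed

end

section \<open>Jordan blocks and unipotents\<close>

context ring
begin

text \<open>With \<open>e = q a\<^sup>p\<close> idempotent, \<open>r = e q\<close> already satisfies \<open>r a\<^sup>p r = r\<close>. The unwanted products
  \<open>r a\<^sup>s r\<close> are removed one by one, from \<open>s = p - 1\<close> down to \<open>s = 0\<close>. To remove \<open>r a\<^sup>t r\<close>, replace
  \<open>r\<close> by \<open>r - a\<^sup>p\<^sup>-\<^sup>t r a\<^sup>t r\<close>; because of \<open>a\<^sup>p\<^sup>+\<^sup>1 = 0\<close>, the relations for the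
  higher exponents persist.\<close>

lemma normalized_quasi_inverse:
  fixes p :: nat
  assumes a [simp]: "a \<in> carrier R" and q [simp]: "q \<in> carrier R"
    and nil: "a [^] Suc p = \<zero>"
    and idem: "q \<otimes> a [^] p \<otimes> (q \<otimes> a [^] p) = q \<otimes> a [^] p"
    and nz: "q \<otimes> a [^] p \<noteq> \<zero>"
  shows "\<exists>r \<in> carrier R. r \<noteq> \<zero> \<and> r \<otimes> (a [^] p \<otimes> r) = r \<and> (\<forall>s<p. r \<otimes> (a [^] s \<otimes> r) = \<zero>)"
proof -
  have a_add: "a [^] i \<otimes> a [^] j = a [^] (i + j)" for i j :: nat by (rule nat_pow_mult[OF a])
  have a_add': "a [^] i \<otimes> (a [^] j \<otimes> y) = a [^] (i + j) \<otimes> y" if "y \<in> carrier R" for i j :: nat and y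
    using that by (simp only: a_add[symmetric] m_assoc a nat_pow_closed)
  have big: "a [^] i = \<zero>" if "p < i" for i :: nat
  proof -
    have "a [^] i = a [^] Suc p \<otimes> a [^] (i - Suc p)" using that by (simp only: a_add) simp
    then show ?thesis by (simp only: nil) simp
  qed
  have "\<exists>r \<in> carrier R. r \<noteq> \<zero> \<and> r \<otimes> (a [^] p \<otimes> r) = r \<and> (\<forall>s<p. p - k \<le> s \<longrightarrow> r \<otimes> (a [^] s \<otimes> r) = \<zero>)"
    if "k \<le> p" for k
    using that
  proof (induction k)
    case 0
    let ?e = "q \<otimes> a [^] p"
    let ?r = "?e \<otimes> q"
    have e: "?e \<in> carrier R" by simp
    have "?r \<otimes> (a [^] p \<otimes> ?r) = ?e \<otimes> ?e \<otimes> ?r" by (simp add: m_assoc)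
    also have "\<dots> = ?e \<otimes> ?r" by (simp only: idem)
    also have "\<dots> = ?e \<otimes> ?e \<otimes> q" by (rule m_assoc[symmetric]) auto
    also have "\<dots> = ?r" by (simp only: idem)
    finally have 1: "?r \<otimes> (a [^] p \<otimes> ?r) = ?r" .
    have 2: "?r \<noteq> \<zero>"
    proof
      assume "?r = \<zero>"
      moreover have "?r \<otimes> a [^] p = ?e \<otimes> ?e" by (rule m_assoc) auto
      ultimately have "?e \<otimes> ?e = \<zero>" by (metis l_null nat_pow_closed a)
      then show False using nz by (simp only: idem)
    qed
    show ?case using 1 2 by (intro bexI[of _ ?r]) auto
  next
    case (Suc k)
    then obtain r where r [simp]: "r \<in> carrier R" and rn: "r \<noteq> \<zero>" and rp: "r \<otimes> (a [^] p \<otimes> r) = r"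
      and rs: "\<And>s. s < p \<Longrightarrow> p - k \<le> s \<Longrightarrow> r \<otimes> (a [^] s \<otimes> r) = \<zero>" by auto
    define t where "t = p - Suc k"
    have tp: "t < p" using Suc.prems by (simp add: t_def)
    define x where "x = r \<otimes> (a [^] t \<otimes> r)"
    have x [simp]: "x \<in> carrier R" by (simp add: x_def)
    define r' where "r' = r \<ominus> a [^] (p - t) \<otimes> x"
    have r' [simp]: "r' \<in> carrier R" by (simp add: r'_def)
    have rp_x: "r \<otimes> (a [^] p \<otimes> x) = x"
    proof -
      have "r \<otimes> (a [^] p \<otimes> x) = (r \<otimes> (a [^] p \<otimes> r)) \<otimes> (a [^] t \<otimes> r)" by (simp add: x_def m_assoc)
      then show ?thesis by (simp only: rp x_def)
    qed
    have x_rp: "x \<otimes> (a [^] p \<otimes> r) = x"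
    proof -
      have "x \<otimes> (a [^] p \<otimes> r) = r \<otimes> (a [^] t \<otimes> (r \<otimes> (a [^] p \<otimes> r)))" by (simp add: x_def m_assoc)
      then show ?thesis by (simp only: rp x_def)
    qed
    have x_rs: "x \<otimes> (a [^] s \<otimes> r) = \<zero>" if "s < p" "t < s" for s
    proof -
      have "x \<otimes> (a [^] s \<otimes> r) = r \<otimes> (a [^] t \<otimes> (r \<otimes> (a [^] s \<otimes> r)))" by (simp add: x_def m_assoc)
      also have "\<dots> = \<zero>" using rs[of s] that by (simp add: t_def)
      finally show ?thesis .
    qed
    have up: "a [^] s \<otimes> (a [^] (p - t) \<otimes> x) = a [^] (s + (p - t)) \<otimes> x" for s :: nat by (rule a_add') simp
    have as: "a [^] s \<otimes> r' = a [^] s \<otimes> r \<ominus> a [^] (s + (p - t)) \<otimes> x" for s :: nat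
      unfolding r'_def by (simp add: minus_eq r_distr r_minus up)
    have expand: "r' \<otimes> y = r \<otimes> y \<ominus> a [^] (p - t) \<otimes> (x \<otimes> y)" if "y \<in> carrier R" for y
      using that unfolding r'_def by (simp add: minus_eq l_distr l_minus m_assoc)
    have hi: "a [^] s \<otimes> r' = a [^] s \<otimes> r" if "t < s" for s
      unfolding as using big[of "s + (p - t)"] that tp by (simp add: minus_eq)
    have rp': "r' \<otimes> (a [^] p \<otimes> r') = r'"
      unfolding hi[OF tp] by (simp add: expand rp x_rp) (simp add: r'_def)
    have rs': "r' \<otimes> (a [^] s \<otimes> r') = \<zero>" if s: "s < p" "t < s" for s
      unfolding hi[OF s(2)] using rs[of s] s by (simp add: expand x_rs) (simp add: minus_eq t_def)
    have at: "a [^] t \<otimes> r' = a [^] t \<otimes> r \<ominus> a [^] p \<otimes> x" using as[of t] tp by simp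
    have 0: "r \<otimes> (a [^] t \<otimes> r \<ominus> a [^] p \<otimes> x) = \<zero>"
      by (simp add: minus_eq r_distr r_minus rp_x) (simp add: x_def[symmetric] r_neg)
    have xe: "x \<otimes> y = r \<otimes> (a [^] t \<otimes> (r \<otimes> y))" if "y \<in> carrier R" for y
      using that by (simp add: x_def m_assoc)
    have rt': "r' \<otimes> (a [^] t \<otimes> r') = \<zero>"
      unfolding at by (simp add: expand 0 xe)
    have "r' \<noteq> \<zero>"
    proof
      assume "r' = \<zero>"
      then have "a [^] p \<otimes> r' = \<zero>" by simp
      then have "a [^] p \<otimes> r = \<zero>" by (simp add: hi[OF tp])
      then show False using rp rn by simp
    qed
    moreover have "r' \<otimes> (a [^] s \<otimes> r') = \<zero>" if "s < p" "p - Suc k \<le> s" for s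
      using rs'[of s] rt' that by (cases "s = t") (auto simp: t_def)
    ultimately show ?case using rp' by (intro bexI[of _ r']) auto
  qed
  from this[of p] show ?thesis by auto
qed

text \<open>If \<open>e\<close> and \<open>f\<close> are the matrix units of positions 12 and 21, the product is the matrix with rows
  \<open>(2, 1)\<close> and \<open>(1, 1)\<close>. Subtracting the identity leaves \<open>y = e + f + e f\<close>, which satisfies
  \<open>y\<^sup>2 = y + 1\<close> on the block and is therefore invertible there. The proof uses this in the form
  \<open>y (y - 1) f = f\<close>.\<close>

lemma golden_product_not_unipotent:
  assumes [simp]: "e \<in> carrier R" "f \<in> carrier R"
    and ee: "e \<otimes> e = \<zero>" and ff: "f \<otimes> f = \<zero>"
    and efe: "e \<otimes> (f \<otimes> e) = e" and fef: "f \<otimes> (e \<otimes> f) = f" and "f \<noteq> \<zero>"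
  shows "\<not> unipotent_elem R ((\<one> \<oplus> e) \<otimes> (\<one> \<oplus> f))"
proof
  assume "unipotent_elem R ((\<one> \<oplus> e) \<otimes> (\<one> \<oplus> f))"
  define z where "z = \<one> \<ominus> (\<one> \<oplus> e) \<otimes> (\<one> \<oplus> f)"
  then obtain n :: nat where n: "z [^] n = \<zero>"
    using \<open>unipotent_elem R _\<close> by (auto simp: unipotent_elem_def nilpotent_elem_def)
  have z [simp]: "z \<in> carrier R" by (simp add: z_def)
  \<comment> \<open>The element \<open>z\<close> of the definition of unipotence is \<open>- y\<close>, so that \<open>y (y - 1) = z (z + 1)\<close>.\<close>
  define y where "y = e \<oplus> f \<oplus> e \<otimes> f"
  have y [simp]: "y \<in> carrier R" by (simp add: y_def)
  have zy: "z = \<ominus> y"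
  proof -
    have "(\<one> \<oplus> e) \<otimes> (\<one> \<oplus> f) = \<one> \<oplus> y" unfolding y_def by (simp add: l_distr r_distr a_ac)
    then show ?thesis unfolding z_def by (simp add: minus_eq minus_add r_neg1 r_neg2)
  qed
  have efx: "e \<otimes> (f \<otimes> (e \<otimes> x)) = e \<otimes> x" if "x \<in> carrier R" for x
    using that efe by (metis m_assoc m_closed assms(1,2))
  have eex: "e \<otimes> (e \<otimes> x) = \<zero>" if "x \<in> carrier R" for x
    using that ee by (metis m_assoc l_null assms(1))
  have yf: "y \<otimes> f = e \<otimes> f"
    unfolding y_def by (simp add: l_distr m_assoc ff)
  have yef: "y \<otimes> (e \<otimes> f) = f \<oplus> e \<otimes> f"
    unfolding y_def by (simp add: l_distr m_assoc eex efx fef)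
  have zzf: "z \<otimes> (z \<oplus> \<one>) \<otimes> f = f"
  proof -
    have "z \<otimes> (z \<oplus> \<one>) \<otimes> f = y \<otimes> (y \<otimes> f) \<ominus> y \<otimes> f"
      unfolding zy by (simp add: l_distr r_distr m_assoc l_minus r_minus minus_eq)
    also have "\<dots> = f" unfolding yf yef by (simp add: minus_eq a_assoc r_neg)
    finally show ?thesis .
  qed
  have it: "(z \<otimes> (z \<oplus> \<one>)) [^] k \<otimes> f = f" for k :: nat
    by (induction k) (simp_all add: m_assoc zzf[unfolded m_assoc[OF z _ assms(2)]])
  have "z \<otimes> (z \<oplus> \<one>) = (z \<oplus> \<one>) \<otimes> z" by (simp add: l_distr r_distr)
  then have "(z \<otimes> (z \<oplus> \<one>)) [^] n = z [^] n \<otimes> (z \<oplus> \<one>) [^] n"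
    by (intro pow_mult_distrib) auto
  then have "(z \<otimes> (z \<oplus> \<one>)) [^] n = \<zero>" by (simp add: n)
  then show False using it[of n] \<open>f \<noteq> \<zero>\<close> by simp
qed

end

section \<open>Subgroups of the unit group normalized by given units\<close>

text \<open>The situation of one step of the subnormal chain: \<open>T\<close> is part of a term of the chain and \<open>K\<close> is the
  next term, in which certain elements have to be found.\<close>

locale normalized_unit_subgroup = ring R for R (structure) +
  fixes K T :: "'a set"
  assumes K_subgroup: "subgroup K (units_of R)"
    and T_Units: "T \<subseteq> Units R"
    and T_conj: "t \<in> T \<Longrightarrow> k \<in> K \<Longrightarrow> t \<otimes> k \<otimes> inv t \<in> K"
begin

lemma K_Units: "k \<in> K \<Longrightarrow> k \<in> Units R"
  using subgroup.subset[OF K_subgroup] by (auto simp: units_of_carrier)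

lemma K_mult: "k \<in> K \<Longrightarrow> l \<in> K \<Longrightarrow> k \<otimes> l \<in> K"
  using subgroup.m_closed[OF K_subgroup] by (simp add: units_of_mult)

lemma K_inv: "k \<in> K \<Longrightarrow> inv k \<in> K"
  using subgroup.m_inv_closed[OF K_subgroup] K_Units by (simp add: units_of_inv)

text \<open>The equation says that \<open>z\<close> is the commutator \<open>x y x\<^sup>-\<^sup>1 y\<^sup>-\<^sup>1\<close>. It is put without inverses so that it
  can be checked by expanding products.\<close>

lemma commutator_mem:
  assumes "x \<in> K \<and> y \<in> T \<or> x \<in> T \<and> y \<in> K"
    and z: "z \<in> carrier R" and comm: "x \<otimes> y = z \<otimes> (y \<otimes> x)"
  shows "z \<in> K"
proof -
  have x: "x \<in> Units R" and y: "y \<in> Units R" using assms(1) K_Units T_Units by auto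
  have "x \<otimes> y \<otimes> inv x \<otimes> inv y = z \<otimes> (y \<otimes> x) \<otimes> inv x \<otimes> inv y" by (simp only: comm)
  also have "\<dots> = z" using x y z by (simp add: m_assoc Units_closed)
  finally have z_eq: "x \<otimes> y \<otimes> inv x \<otimes> inv y = z" .
  show ?thesis
    using assms(1)
  proof
    assume "x \<in> K \<and> y \<in> T"
    then have "x \<otimes> (y \<otimes> inv x \<otimes> inv y) \<in> K" using K_mult K_inv T_conj by blast
    then show ?thesis using z_eq x y by (simp add: m_assoc Units_closed)
  next
    assume "x \<in> T \<and> y \<in> K"
    then have "x \<otimes> y \<otimes> inv x \<otimes> inv y \<in> K" using K_mult K_inv T_conj by blast
    then show ?thesis by (simp only: z_eq)
  qed
qed

lemma root_commutator_mem:
  assumes "\<one> \<oplus> e \<in> K \<and> \<one> \<oplus> f \<in> T \<or> \<one> \<oplus> e \<in> T \<and> \<one> \<oplus> f \<in> K"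
    and [simp]: "e \<in> carrier R" "f \<in> carrier R"
    and "e \<otimes> e = \<zero>" "f \<otimes> f = \<zero>" "f \<otimes> e = \<zero>"
  shows "\<one> \<oplus> e \<otimes> f \<in> K"
proof (rule commutator_mem[OF assms(1)])
  show "(\<one> \<oplus> e) \<otimes> (\<one> \<oplus> f) = (\<one> \<oplus> e \<otimes> f) \<otimes> ((\<one> \<oplus> f) \<otimes> (\<one> \<oplus> e))"
    using assms(4-6) by (simp add: l_distr r_distr m_assoc a_ac)
qed simp

lemma braid_mem:
  assumes u: "u \<in> K" and t: "t \<in> T" and braid: "u \<otimes> t \<otimes> u = t \<otimes> u \<otimes> t"
  shows "t \<in> K"
proof -
  have uU: "u \<in> Units R" and tU: "t \<in> Units R" using u t K_Units T_Units by auto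
  have "u \<otimes> (t \<otimes> u \<otimes> inv t) \<otimes> inv u = (u \<otimes> t \<otimes> u) \<otimes> inv t \<otimes> inv u"
    using uU tU by (simp add: m_assoc Units_closed)
  also have "\<dots> = t" unfolding braid using uU tU by (simp add: m_assoc Units_closed)
  finally have "u \<otimes> (t \<otimes> u \<otimes> inv t) \<otimes> inv u = t" .
  moreover have "u \<otimes> (t \<otimes> u \<otimes> inv t) \<otimes> inv u \<in> K" using u t K_mult K_inv T_conj by blast
  ultimately show ?thesis by simp
qed

text \<open>For indices \<open>x, y, w\<close> that are pairwise distinct, the transvection at \<open>(x, w)\<close> is the commutator of
  those at \<open>(x, y)\<close> and \<open>(y, w)\<close>; it belongs to \<open>K\<close> if one of these two does. Starting from
  \<open>(i, k)\<close>, all six positions are reached.\<close>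

lemma root_generators_mem:
  fixes e :: "'i \<Rightarrow> 'i \<Rightarrow> 'a"
  assumes dist: "distinct [i, j, k]"
    and e: "\<And>x y. x \<in> {i, j, k} \<Longrightarrow> y \<in> {i, j, k} \<Longrightarrow> e x y \<in> carrier R"
    and mult: "\<And>x y z w. x \<in> {i, j, k} \<Longrightarrow> y \<in> {i, j, k} \<Longrightarrow> z \<in> {i, j, k} \<Longrightarrow> w \<in> {i, j, k} \<Longrightarrow>
      e x y \<otimes> e z w = (if y = z then e x w else \<zero>)"
    and T: "T = {\<one> \<oplus> e x y | x y. x \<in> {i, j, k} \<and> y \<in> {i, j, k} \<and> x \<noteq> y}"
    and start: "\<one> \<oplus> e i k \<in> K"
  shows "T \<subseteq> K"
proof -
  have step: "\<one> \<oplus> e x w \<in> K"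
    if "x \<in> {i, j, k}" "y \<in> {i, j, k}" "w \<in> {i, j, k}" "x \<noteq> y" "y \<noteq> w" "x \<noteq> w"
      and "\<one> \<oplus> e x y \<in> K \<or> \<one> \<oplus> e y w \<in> K" for x y w
  proof -
    have "\<one> \<oplus> e x y \<in> T" "\<one> \<oplus> e y w \<in> T" using that unfolding T by blast+
    then have "\<one> \<oplus> e x y \<otimes> e y w \<in> K"
      using that mult e by (intro root_commutator_mem) auto
    then show ?thesis using mult that by simp
  qed
  have ij: "\<one> \<oplus> e i j \<in> K" by (rule step[of i k j]) (use start dist in auto)
  have jk: "\<one> \<oplus> e j k \<in> K" by (rule step[of j i k]) (use start dist in auto)
  have kj: "\<one> \<oplus> e k j \<in> K" by (rule step[of k i j]) (use ij dist in auto)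
  have ji: "\<one> \<oplus> e j i \<in> K" by (rule step[of j k i]) (use jk dist in auto)
  have ki: "\<one> \<oplus> e k i \<in> K" by (rule step[of k j i]) (use kj dist in auto)
  show ?thesis unfolding T using ij jk kj ji ki start by auto
qed

end

section \<open>Units that force a non-unipotent element\<close>

context ring
begin

lemma square_zero_Units:
  assumes [simp]: "x \<in> carrier R" and "x \<otimes> x = \<zero>"
  shows "\<one> \<oplus> x \<in> Units R"
proof -
  have "nilpotent_elem R (\<ominus> x)"
    unfolding nilpotent_elem_def using assms
    by (intro conjI exI[of _ "2::nat"]) (auto simp: numeral_2_eq_2 l_minus r_minus)
  from one_minus_nilpotent_Units[OF this] show ?thesis by (simp add: minus_eq)
qed

text \<open>The right-hand side is symmetric in \<open>e\<close> and \<open>f\<close>. So if also \<open>f e f = - f\<close>, exchanging \<open>e\<close> and \<open>f\<close>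
  gives the braid relation between \<open>1 + e + b\<close> and \<open>1 + f + b\<close>. The model is \<open>e = E\<^sub>1\<^sub>2\<close>,
  \<open>f = - E\<^sub>2\<^sub>1\<close>, the standard generators of the modular group, with \<open>b\<close> living on a complementary
  block.\<close>

lemma square_zero_braid:
  assumes [simp]: "e \<in> carrier R" "f \<in> carrier R" "b \<in> carrier R"
    and "e \<otimes> e = \<zero>" "f \<otimes> f = \<zero>" "b \<otimes> b = \<zero>"
    and "e \<otimes> b = \<zero>" "b \<otimes> e = \<zero>" "f \<otimes> b = \<zero>" "b \<otimes> f = \<zero>"
    and "e \<otimes> (f \<otimes> e) = \<ominus> e"
  shows "(\<one> \<oplus> e \<oplus> b) \<otimes> (\<one> \<oplus> f \<oplus> b) \<otimes> (\<one> \<oplus> e \<oplus> b) =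
    \<one> \<oplus> (e \<oplus> f) \<oplus> (e \<otimes> f \<oplus> f \<otimes> e) \<oplus> (b \<oplus> b \<oplus> b)"
proof -
  have "(\<one> \<oplus> e \<oplus> b) \<otimes> (\<one> \<oplus> f \<oplus> b) = \<one> \<oplus> e \<oplus> f \<oplus> e \<otimes> f \<oplus> (b \<oplus> b)"
    using assms(4-) by (simp add: l_distr r_distr m_assoc a_ac)
  then have "(\<one> \<oplus> e \<oplus> b) \<otimes> (\<one> \<oplus> f \<oplus> b) \<otimes> (\<one> \<oplus> e \<oplus> b) =
      (\<one> \<oplus> (e \<oplus> f) \<oplus> (e \<otimes> f \<oplus> f \<otimes> e) \<oplus> (b \<oplus> b \<oplus> b)) \<oplus> (e \<oplus> \<ominus> e)"
    using assms(4-) by (simp add: l_distr r_distr m_assoc a_ac)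
  then show ?thesis by (simp add: r_neg)
qed

text \<open>Here \<open>e = a r a\<close> and \<open>r\<close> behave like the matrix units of positions 12 and 21, and \<open>b = a - e\<close>
  annihilates both, so \<open>1 + a = 1 + e + b\<close> is a transvection up to a part on a complementary block.
  The unit \<open>t = 1 - r + b\<close> copies that part: this preserves the braid relation with \<open>1 + a\<close>, and it
  makes the part cancel in \<open>(1 + a) t\<^sup>-\<^sup>1 = (1 + e) (1 + r)\<close>.\<close>

lemma non_unipotent_witness_index_two:
  assumes [simp]: "a \<in> carrier R" "r \<in> carrier R"
    and aa: "a \<otimes> a = \<zero>" and rr: "r \<otimes> r = \<zero>" and rar: "r \<otimes> (a \<otimes> r) = r" and rn: "r \<noteq> \<zero>"
  shows "\<exists>T \<subseteq> Units R. \<forall>K. subgroup K (units_of R) \<and> \<one> \<oplus> a \<in> K \<and>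
      (\<forall>t\<in>T. \<forall>k\<in>K. t \<otimes> k \<otimes> inv t \<in> K) \<longrightarrow> T \<subseteq> K \<and> (\<exists>w\<in>K. \<not> unipotent_elem R w)"
proof -
  define e where "e = a \<otimes> (r \<otimes> a)"
  define b where "b = a \<ominus> e"
  have e [simp]: "e \<in> carrier R" and b [simp]: "b \<in> carrier R" by (simp_all add: e_def b_def)
  have aax: "a \<otimes> (a \<otimes> x) = \<zero>" and rarx: "r \<otimes> (a \<otimes> (r \<otimes> x)) = r \<otimes> x" if "x \<in> carrier R" for x
    using that aa rar by (metis m_assoc l_null m_closed assms(1,2))+
  have ee: "e \<otimes> e = \<zero>" and ea: "e \<otimes> a = \<zero>" and ae: "a \<otimes> e = \<zero>"
    and er: "e \<otimes> r = a \<otimes> r" and re: "r \<otimes> e = r \<otimes> a"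
    unfolding e_def by (simp_all add: m_assoc aa aax rar rarx)
  have bb: "b \<otimes> b = \<zero>" "e \<otimes> b = \<zero>" "b \<otimes> e = \<zero>" "r \<otimes> b = \<zero>" "b \<otimes> r = \<zero>"
    unfolding b_def by (simp_all add: minus_eq l_distr r_distr l_minus r_minus aa ee ea ae er re r_neg)
  have rer: "r \<otimes> (e \<otimes> r) = r" by (simp only: er rar)
  have "e \<otimes> (r \<otimes> a) = (e \<otimes> r) \<otimes> a" by (rule m_assoc[symmetric]) auto
  also have "\<dots> = a \<otimes> r \<otimes> a" by (simp only: er)
  also have "\<dots> = e" unfolding e_def by (rule m_assoc) auto
  finally have ere: "e \<otimes> (r \<otimes> e) = e" by (simp only: re)
  have u_eq: "\<one> \<oplus> a = \<one> \<oplus> e \<oplus> b"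
    unfolding b_def by (simp add: minus_eq a_assoc a_lcomm[of e a] r_neg)
  define t where "t = \<one> \<oplus> \<ominus> r \<oplus> b"
  have t_eq: "t = (\<one> \<oplus> \<ominus> r) \<otimes> (\<one> \<oplus> b)"
    unfolding t_def using bb by (simp add: l_distr r_distr l_minus a_ac)
  have tU: "t \<in> Units R"
    unfolding t_eq using bb rr by (intro Units_m_closed square_zero_Units) (simp_all add: l_minus r_minus)
  have braid: "(\<one> \<oplus> a) \<otimes> t \<otimes> (\<one> \<oplus> a) = t \<otimes> (\<one> \<oplus> a) \<otimes> t"
    unfolding u_eq t_def
    using square_zero_braid[of e "\<ominus> r" b] square_zero_braid[of "\<ominus> r" e b] ee rr bb ere rer
    by (simp add: l_minus r_minus a_ac)
  have prod: "\<one> \<oplus> a = (\<one> \<oplus> e) \<otimes> (\<one> \<oplus> r) \<otimes> t"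
  proof -
    have "(\<one> \<oplus> r) \<otimes> t = \<one> \<oplus> b \<oplus> (r \<oplus> \<ominus> r)"
      unfolding t_def using bb rr by (simp add: l_distr r_distr r_minus a_ac)
    then have "(\<one> \<oplus> r) \<otimes> t = \<one> \<oplus> b" by (simp add: r_neg)
    then have "(\<one> \<oplus> e) \<otimes> (\<one> \<oplus> r) \<otimes> t = (\<one> \<oplus> e) \<otimes> (\<one> \<oplus> b)"
      using Units_closed[OF tU] by (simp add: m_assoc)
    also have "\<dots> = \<one> \<oplus> e \<oplus> b" using bb by (simp add: l_distr r_distr a_ac)
    finally show ?thesis by (simp only: u_eq)
  qed
  have nu: "\<not> unipotent_elem R ((\<one> \<oplus> e) \<otimes> (\<one> \<oplus> r))"
    by (rule golden_product_not_unipotent) (simp_all add: ee rr ere rer rn)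
  show ?thesis
  proof (intro exI[of _ "{t}"] conjI allI impI)
    show "{t} \<subseteq> Units R" using tU by simp
    fix K assume K: "subgroup K (units_of R) \<and> \<one> \<oplus> a \<in> K \<and>
      (\<forall>t\<in>{t}. \<forall>k\<in>K. t \<otimes> k \<otimes> inv t \<in> K)"
    then interpret normalized_unit_subgroup R K "{t}"

      by (intro normalized_unit_subgroup.intro normalized_unit_subgroup_axioms.intro ring_axioms)
        (use tU in auto)
    have tK: "t \<in> K" using braid_mem[OF _ _ braid] K by simp
    then show "{t} \<subseteq> K" by simp
    have "(\<one> \<oplus> a) \<otimes> inv t \<in> K" using K_mult K_inv K tK by blast
    moreover have "(\<one> \<oplus> a) \<otimes> inv t = (\<one> \<oplus> e) \<otimes> (\<one> \<oplus> r)"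
      unfolding prod using tU by (simp add: m_assoc Units_closed)
    ultimately show "\<exists>w\<in>K. \<not> unipotent_elem R w" using nu by auto
  qed
qed

text \<open>The elements \<open>e i j\<close> are matrix units for which left multiplication by \<open>a\<close> lowers the first index
  by one, and \<open>a\<close> annihilates \<open>e i p\<close> from the right. Hence the commutator of \<open>1 + a\<close> and
  \<open>1 + e 1 p\<close> is \<open>1 + e 0 p\<close>; the indices \<open>0, 1, p\<close> are distinct because \<open>p \<ge> 2\<close>.\<close>

lemma non_unipotent_witness_higher_index:
  fixes p :: nat
  assumes a [simp]: "a \<in> carrier R" and r [simp]: "r \<in> carrier R"
    and p: "2 \<le> p" and nil: "a [^] Suc p = \<zero>"
    and rp: "r \<otimes> (a [^] p \<otimes> r) = r" and rs: "\<And>s. s < p \<Longrightarrow> r \<otimes> (a [^] s \<otimes> r) = \<zero>"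
    and rn: "r \<noteq> \<zero>"
  shows "\<exists>T \<subseteq> Units R. \<forall>K. subgroup K (units_of R) \<and> \<one> \<oplus> a \<in> K \<and>
      (\<forall>t\<in>T. \<forall>k\<in>K. t \<otimes> k \<otimes> inv t \<in> K) \<longrightarrow> T \<subseteq> K \<and> (\<exists>w\<in>K. \<not> unipotent_elem R w)"
proof -
  define e where "e i j = a [^] (p - i) \<otimes> (r \<otimes> a [^] j)" for i j :: nat
  have e [simp]: "e i j \<in> carrier R" for i j by (simp add: e_def)
  have big: "a [^] i = \<zero>" if "p < i" for i :: nat
  proof -
    have "a [^] i = a [^] Suc p \<otimes> a [^] (i - Suc p)"
      using that by (simp only: nat_pow_mult[OF a]) simp
    then show ?thesis by (simp only: nil) simp
  qed
  have mid: "r \<otimes> (a [^] j \<otimes> a [^] (p - k) \<otimes> r) = (if j = k then r else \<zero>)"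
    if "j \<le> p" "k \<le> p" for j k
    using that rp rs[of "j + (p - k)"] big[of "j + (p - k)"]
    by (cases j k rule: linorder_cases) (simp_all add: nat_pow_mult)
  have mult: "e i j \<otimes> e k l = (if j = k then e i l else \<zero>)" if "j \<le> p" "k \<le> p" for i j k l
  proof -
    have "e i j \<otimes> e k l = a [^] (p - i) \<otimes> ((r \<otimes> (a [^] j \<otimes> a [^] (p - k) \<otimes> r)) \<otimes> a [^] l)"
      unfolding e_def by (simp add: m_assoc)
    then show ?thesis using that by (simp add: mid) (simp add: e_def)
  qed
  have ea: "e i p \<otimes> a = \<zero>" for i
  proof -
    have "e i p \<otimes> a = a [^] (p - i) \<otimes> (r \<otimes> a [^] Suc p)" unfolding e_def by (simp add: m_assoc)
    then show ?thesis by (simp only: nil) simp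
  qed
  have ae: "a \<otimes> e 1 p = e 0 p"
  proof -
    have "a \<otimes> e 1 p = (a \<otimes> a [^] (p - 1)) \<otimes> (r \<otimes> a [^] p)" unfolding e_def by (simp add: m_assoc)
    also have "a \<otimes> a [^] (p - 1) = a [^] Suc (p - 1)" by (rule nat_pow_Suc2[OF a, symmetric])
    also have "Suc (p - 1) = p - 0" using p by simp
    finally show ?thesis by (simp only: e_def)
  qed
  let ?I = "{0, 1, p}"
  have I: "i \<le> p" if "i \<in> ?I" for i using that p by auto
  define T where "T = {\<one> \<oplus> e x y | x y. x \<in> ?I \<and> y \<in> ?I \<and> x \<noteq> y}"
  have T_mem: "\<one> \<oplus> e i j \<in> T" if "i \<in> ?I" "j \<in> ?I" "i \<noteq> j" for i j
    using that unfolding T_def by blast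
  have TU: "T \<subseteq> Units R"
    unfolding T_def using I by (auto intro!: square_zero_Units simp: mult)
  have e10: "e 1 0 \<noteq> \<zero>"
  proof
    assume "e 1 0 = \<zero>"
    then have "e p 1 \<otimes> e 1 0 = \<zero>" by simp
    then have "e p 0 = \<zero>" using mult[of 1 1 p 0] p by simp
    then show False using rn by (simp add: e_def)
  qed
  have nu: "\<not> unipotent_elem R ((\<one> \<oplus> e 0 1) \<otimes> (\<one> \<oplus> e 1 0))"
    using p e10 by (intro golden_product_not_unipotent) (simp_all add: mult)
  show ?thesis
  proof (intro exI[of _ T] conjI allI impI)
    show "T \<subseteq> Units R" by (rule TU)
    fix K assume K: "subgroup K (units_of R) \<and> \<one> \<oplus> a \<in> K \<and>
      (\<forall>t\<in>T. \<forall>k\<in>K. t \<otimes> k \<otimes> inv t \<in> K)"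
    then interpret normalized_unit_subgroup R K T

      by (intro normalized_unit_subgroup.intro normalized_unit_subgroup_axioms.intro ring_axioms)
        (use TU in auto)
    have "\<one> \<oplus> e 0 p \<in> K"
    proof (rule commutator_mem[of "\<one> \<oplus> a" "\<one> \<oplus> e 1 p"])
      have "\<one> \<oplus> e 1 p \<in> T" using p by (intro T_mem) auto
      then show "\<one> \<oplus> a \<in> K \<and> \<one> \<oplus> e 1 p \<in> T \<or> \<one> \<oplus> a \<in> T \<and> \<one> \<oplus> e 1 p \<in> K" using K by blast
      have "e 0 p \<otimes> e 1 p = \<zero>" using mult[of p 1 0 p] p by simp
      then show "(\<one> \<oplus> a) \<otimes> (\<one> \<oplus> e 1 p) = (\<one> \<oplus> e 0 p) \<otimes> ((\<one> \<oplus> e 1 p) \<otimes> (\<one> \<oplus> a))"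
        using ea[of 0] ea[of 1] ae by (simp add: l_distr r_distr m_assoc a_ac)
    qed simp
    note start = this
    show TK: "T \<subseteq> K"
    proof (rule root_generators_mem[OF _ e mult T_def start])
      show "distinct [0, 1, p]" using p by simp
      show "y \<le> p" if "y \<in> ?I" for y using that by (rule I)
      show "z \<le> p" if "z \<in> ?I" for z using that by (rule I)
    qed
    have "\<one> \<oplus> e 0 1 \<in> T" "\<one> \<oplus> e 1 0 \<in> T" by (intro T_mem; simp)+
    then have "(\<one> \<oplus> e 0 1) \<otimes> (\<one> \<oplus> e 1 0) \<in> K" using TK K_mult by blast
    then show "\<exists>w\<in>K. \<not> unipotent_elem R w" using nu by blast
  qed
qed

text \<open>The set \<open>T\<close> is what allows a descent along a subnormal chain: it depends on \<open>a\<close> only, and it lies in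
  every subgroup that contains \<open>1 + a\<close> and that it normalizes. The idempotent is taken in the left
  ideal generated by the last nonzero power of \<open>a\<close>.\<close>

lemma non_unipotent_witness:
  assumes a [simp]: "a \<in> carrier R" and an: "a \<noteq> \<zero>" and nil: "nilpotent_elem R a"
    and idem: "\<And>x. x \<in> carrier R \<Longrightarrow> x \<noteq> \<zero> \<Longrightarrow>
      \<exists>q\<in>carrier R. q \<otimes> x \<otimes> (q \<otimes> x) = q \<otimes> x \<and> q \<otimes> x \<noteq> \<zero>"
  shows "\<exists>T \<subseteq> Units R. \<forall>K. subgroup K (units_of R) \<and> \<one> \<oplus> a \<in> K \<and>
      (\<forall>t\<in>T. \<forall>k\<in>K. t \<otimes> k \<otimes> inv t \<in> K) \<longrightarrow> T \<subseteq> K \<and> (\<exists>w\<in>K. \<not> unipotent_elem R w)"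
proof -
  define m where "m = (LEAST n::nat. a [^] n = \<zero>)"
  have m0: "a [^] m = \<zero>"
  proof -
    obtain n :: nat where "a [^] n = \<zero>" using nil by (auto simp: nilpotent_elem_def)
    then show ?thesis unfolding m_def by (rule LeastI)
  qed
  have ml: "a [^] n \<noteq> \<zero>" if "n < m" for n
    using not_less_Least that unfolding m_def by blast
  have "m \<noteq> 0"
  proof
    assume "m = 0"
    then have "\<one> = \<zero>" using m0 by simp
    then show False using an one_zeroD a by blast
  qed
  moreover have "m \<noteq> 1" using m0 an by auto
  ultimately obtain p where mp: "m = Suc p" and p: "1 \<le> p" by (cases m) auto
  have "a [^] p \<noteq> \<zero>" using ml mp by simp
  then obtain q where q: "q \<in> carrier R" "q \<otimes> a [^] p \<otimes> (q \<otimes> a [^] p) = q \<otimes> a [^] p"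
    "q \<otimes> a [^] p \<noteq> \<zero>" using idem[OF nat_pow_closed[OF a]] by blast
  have nilp: "a [^] Suc p = \<zero>" using m0 mp by (simp only:)
  obtain r where r: "r \<in> carrier R" "r \<noteq> \<zero>" "r \<otimes> (a [^] p \<otimes> r) = r"
    "\<And>s. s < p \<Longrightarrow> r \<otimes> (a [^] s \<otimes> r) = \<zero>"
    using normalized_quasi_inverse[OF a q(1) nilp q(2,3)] by blast
  show ?thesis
  proof (cases "p = 1")
    case True
    have "a \<otimes> a = \<zero>" using nilp True by simp
    moreover have "r \<otimes> r = \<zero>" using r(4)[of 0] r(1) True by simp
    moreover have "r \<otimes> (a \<otimes> r) = r" using r(3) True by simp
    ultimately show ?thesis using r(1,2) by (intro non_unipotent_witness_index_two[of a r]) auto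
  next
    case False
    then show ?thesis
      using p r nilp by (intro non_unipotent_witness_higher_index[of a r p]) auto
  qed
qed

end

section \<open>Subnormal subgroups\<close>

context group
begin

lemma normal_in_subgroup_iff:
  assumes H: "subgroup H G"
  shows "U \<lhd> G\<lparr>carrier := H\<rparr> \<longleftrightarrow>
    subgroup U G \<and> U \<subseteq> H \<and> (\<forall>x\<in>H. \<forall>u\<in>U. x \<otimes> u \<otimes> inv x \<in> U)"
proof -
  interpret GH: group "G\<lparr>carrier := H\<rparr>" using subgroup.subgroup_is_group[OF H is_group] .
  have "subgroup U (G\<lparr>carrier := H\<rparr>) \<longleftrightarrow> subgroup U G \<and> U \<subseteq> H"
    using incl_subgroup[OF H] subgroup_incl[OF _ H] subgroup.subset[of U "G\<lparr>carrier := H\<rparr>"] by auto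
  then show ?thesis
    unfolding GH.normal_inv_iff using m_inv_consistent[OF H] by auto
qed

lemma subnormal_chain_subgroup:
  assumes "N (0::nat) = carrier G" "\<And>i. i < n \<Longrightarrow> N (Suc i) \<lhd> G\<lparr>carrier := N i\<rparr>" "i \<le> n"
  shows "subgroup (N i) G"
  using assms(3)
proof (induction i)
  case 0
  show ?case using assms(1) subgroup_self by simp
next
  case (Suc i)
  then show ?case using normal_in_subgroup_iff[of "N i"] assms(2)[of i] by simp
qed

lemma subnormal_imp_subgroup:
  assumes "subnormal H G"
  shows "subgroup H G"
  using assms subnormal_chain_subgroup unfolding subnormal_def by blast

text \<open>The chain from \<open>G\<close> down to \<open>H\<close> is prolonged by \<open>U\<close>.\<close>

lemma normal_in_subnormal:
  assumes "subnormal H G" "U \<lhd> G\<lparr>carrier := H\<rparr>"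
  shows "subnormal U G"
proof -
  obtain n :: nat and N where N: "N 0 = carrier G" "N n = H"
    "\<And>i. i < n \<Longrightarrow> N (Suc i) \<lhd> G\<lparr>carrier := N i\<rparr>"
    using assms(1) unfolding subnormal_def by blast
  let ?M = "N(Suc n := U)"
  have "?M (Suc i) \<lhd> G\<lparr>carrier := ?M i\<rparr>" if "i < Suc n" for i
    using that N assms(2) by (cases "i = n") auto
  moreover have "?M 0 = carrier G" "?M (Suc n) = U" using N by auto
  ultimately show ?thesis unfolding subnormal_def by blast
qed

lemma subnormal_carrier: "subnormal (carrier G) G"
  unfolding subnormal_def by (intro exI[of _ 0] exI[of _ "\<lambda>_. carrier G"]) simp

end

section \<open>Reduction modulo the Jacobson radical\<close>

text \<open>The quotient by the radical is used only through the projection \<open>h\<close>, which keeps cosets out of the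
  calculations.\<close>

locale radical_quotient = strongly_pi_regular_ring R + hom: ring_hom_ring R S h
  for R :: "('a, 'm) ring_scheme" (structure) and S :: "('b, 'n) ring_scheme" and h +
  assumes surj: "h ` carrier R = carrier S"
    and ker: "x \<in> carrier R \<Longrightarrow> h x = \<zero>\<^bsub>S\<^esub> \<longleftrightarrow> x \<in> jacobson_radical R"
begin

lemma hom_eq_one_iff:
  assumes x: "x \<in> carrier R"
  shows "h x = \<one>\<^bsub>S\<^esub> \<longleftrightarrow> \<one> \<ominus> x \<in> jacobson_radical R"
proof -
  have "h (\<one> \<ominus> x) = \<one>\<^bsub>S\<^esub> \<ominus>\<^bsub>S\<^esub> h x" using x by (simp add: minus_eq hom.S.minus_eq)
  then have "h (\<one> \<ominus> x) = \<zero>\<^bsub>S\<^esub> \<longleftrightarrow> h x = \<one>\<^bsub>S\<^esub>"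
    using x by (metis hom.S.r_right_minus_eq hom.S.one_closed hom.hom_closed)
  then show ?thesis using ker[of "\<one> \<ominus> x"] x by simp
qed

lemma hom_eq_one_Units:
  assumes x: "x \<in> carrier R" and "h x = \<one>\<^bsub>S\<^esub>"
  shows "x \<in> Units R"
proof -
  have "nilpotent_elem R (\<one> \<ominus> x)" using assms hom_eq_one_iff jacobson_radical_nil by blast
  then have "\<one> \<ominus> (\<one> \<ominus> x) \<in> Units R" by (rule one_minus_nilpotent_Units)
  moreover have "\<one> \<ominus> (\<one> \<ominus> x) = x"
    using x by (simp add: minus_eq minus_add r_neg1 r_neg2)
  ultimately show ?thesis by simp
qed

lemma one_plus_jacobson_radical:
  "\<one> <+ jacobson_radical R = {x \<in> Units R. h x = \<one>\<^bsub>S\<^esub>}"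
proof (intro equalityI subsetI)
  interpret J: ideal "jacobson_radical R" R by (rule jacobson_radical_ideal)
  fix x assume "x \<in> \<one> <+ jacobson_radical R"
  then obtain j where j: "j \<in> jacobson_radical R" "x = \<one> \<oplus> j" by (auto simp: a_l_coset_def')
  then have jR: "j \<in> carrier R" using J.a_Hcarr by blast
  have "h x = \<one>\<^bsub>S\<^esub>" using j jR ker[OF jR] by simp
  then show "x \<in> {x \<in> Units R. h x = \<one>\<^bsub>S\<^esub>}" using hom_eq_one_Units[of x] j(2) jR by simp
next
  interpret J: ideal "jacobson_radical R" R by (rule jacobson_radical_ideal)
  fix x assume "x \<in> {x \<in> Units R. h x = \<one>\<^bsub>S\<^esub>}"
  then have x: "x \<in> carrier R" "\<one> \<ominus> x \<in> jacobson_radical R" using hom_eq_one_iff by auto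
  have "x = \<one> \<oplus> \<ominus> (\<one> \<ominus> x)"
    using x(1) by (simp add: minus_eq minus_add r_neg1 r_neg2)
  moreover have "\<ominus> (\<one> \<ominus> x) \<in> jacobson_radical R" using J.a_inv_closed[OF x(2)] .
  ultimately show "x \<in> \<one> <+ jacobson_radical R" unfolding a_l_coset_def' by blast
qed

lemma hom_Units: "x \<in> Units R \<Longrightarrow> h x \<in> Units S"
proof -
  assume x: "x \<in> Units R"
  then have "h (inv x) \<otimes>\<^bsub>S\<^esub> h x = h (inv x \<otimes> x)" "h x \<otimes>\<^bsub>S\<^esub> h (inv x) = h (x \<otimes> inv x)"
    by (simp_all only: hom.hom_mult Units_closed Units_inv_closed)
  then have "h (inv x) \<otimes>\<^bsub>S\<^esub> h x = \<one>\<^bsub>S\<^esub>" "h x \<otimes>\<^bsub>S\<^esub> h (inv x) = \<one>\<^bsub>S\<^esub>" using x by simp_all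
  then show "h x \<in> Units S" using x hom.hom_closed
    unfolding Units_def[of S] by (blast intro: Units_closed Units_inv_closed)
qed

text \<open>If \<open>x\<close> and \<open>x'\<close> lift a unit and its inverse, then \<open>x x'\<close> and \<open>x' x\<close> are congruent to \<open>1\<close> modulo a
  nil ideal. Both are units, so \<open>x\<close> has a right and a left inverse.\<close>

lemma Units_lift:
  assumes y: "y \<in> Units S"
  shows "\<exists>x \<in> Units R. h x = y"
proof -
  obtain x x' where x: "x \<in> carrier R" "h x = y" and x': "x' \<in> carrier R" "h x' = inv\<^bsub>S\<^esub> y"
    using surj y hom.S.Units_closed hom.S.Units_inv_closed by (metis imageE)
  let ?l = "inv (x' \<otimes> x) \<otimes> x'" and ?r = "x' \<otimes> inv (x \<otimes> x')"
  have U: "x \<otimes> x' \<in> Units R" "x' \<otimes> x \<in> Units R"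
    using x x' y by (auto intro!: hom_eq_one_Units)
  have lr: "?l \<in> carrier R" "?r \<in> carrier R" using U x(1) x'(1) by simp_all
  have "x \<otimes> ?r = (x \<otimes> x') \<otimes> inv (x \<otimes> x')" using U x(1) x'(1) by (intro m_assoc[symmetric]) auto
  then have r: "x \<otimes> ?r = \<one>" using U by simp
  have "?l \<otimes> x = inv (x' \<otimes> x) \<otimes> (x' \<otimes> x)" using U x(1) x'(1) by (intro m_assoc) auto
  then have l: "?l \<otimes> x = \<one>" using U by simp
  have "?l = ?r" using l r x(1) lr by (rule inv_unique)
  then have "?r \<otimes> x = \<one>" using l by simp
  then have "x \<in> Units R" unfolding Units_def using r x(1) lr(2) by blast
  then show ?thesis using x(2) by blast
qed

lemma units_hom: "group_hom (units_of R) (units_of S) h"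
  by (intro group_hom.intro group_hom_axioms.intro units_group hom.S.units_group homI)
    (simp_all add: units_of_carrier units_of_mult hom_Units Units_closed)

lemma hom_inv: "x \<in> Units R \<Longrightarrow> h (inv x) = inv\<^bsub>S\<^esub> h x"
  using group_hom.hom_inv[OF units_hom, of x] units_of_inv[of x] hom.S.units_of_inv[OF hom_Units, of x]
  by (simp add: units_of_carrier)

lemma hom_nilpotent: "nilpotent_elem R x \<Longrightarrow> nilpotent_elem S (h x)"
  unfolding nilpotent_elem_def by (metis hom.hom_closed hom.hom_nat_pow hom.hom_zero)

lemma hom_unipotent:
  assumes "unipotent_elem R x"
  shows "unipotent_elem S (h x)"
proof -
  have x: "x \<in> carrier R" "nilpotent_elem R (\<one> \<ominus> x)"
    using assms by (auto simp: unipotent_elem_def)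
  have "h (\<one> \<ominus> x) = \<one>\<^bsub>S\<^esub> \<ominus>\<^bsub>S\<^esub> h x" using x(1) by (simp add: minus_eq hom.S.minus_eq)
  then show ?thesis using hom_nilpotent[OF x(2)] x(1) by (simp add: unipotent_elem_def)
qed

lemma quotient_idempotent_multiple:
  assumes y: "y \<in> carrier S" "y \<noteq> \<zero>\<^bsub>S\<^esub>"
  shows "\<exists>q \<in> carrier S. q \<otimes>\<^bsub>S\<^esub> y \<otimes>\<^bsub>S\<^esub> (q \<otimes>\<^bsub>S\<^esub> y) = q \<otimes>\<^bsub>S\<^esub> y \<and> q \<otimes>\<^bsub>S\<^esub> y \<noteq> \<zero>\<^bsub>S\<^esub>"
proof -
  have "y \<in> h ` carrier R" unfolding surj by (rule y(1))
  then obtain x where x: "x \<in> carrier R" "h x = y" by (elim imageE) simp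
  then have "x \<notin> jacobson_radical R" using ker y(2) by blast
  then obtain q where q: "q \<in> carrier R" "q \<otimes> x \<otimes> (q \<otimes> x) = q \<otimes> x" "q \<otimes> x \<notin> jacobson_radical R"
    using not_jacobson_radical_idempotent_multiple[OF x(1)] by blast
  have qy: "h q \<otimes>\<^bsub>S\<^esub> y = h (q \<otimes> x)" unfolding x(2)[symmetric] using q(1) x(1) by simp
  have "h (q \<otimes> x) \<otimes>\<^bsub>S\<^esub> h (q \<otimes> x) = h (q \<otimes> x \<otimes> (q \<otimes> x))" using q(1) x(1) by simp
  also have "\<dots> = h (q \<otimes> x)" by (simp only: q(2))
  finally have "h (q \<otimes> x) \<otimes>\<^bsub>S\<^esub> h (q \<otimes> x) = h (q \<otimes> x)" .
  moreover have "h (q \<otimes> x) \<noteq> \<zero>\<^bsub>S\<^esub>" using ker[of "q \<otimes> x"] q x(1) by blast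
  ultimately show ?thesis
    using q(1) by (intro bexI[of _ "h q"]) (simp_all only: qy hom.hom_closed simp_thms)
qed

text \<open>Let \<open>h u = 1 + a\<close> with \<open>a \<noteq> 0\<close>, and let \<open>T\<close> be the set of units that \<open>non_unipotent_witness\<close>
  attaches to \<open>a\<close>. By induction on \<open>i\<close>, the image of the term \<open>N i\<close> contains \<open>T\<close>: the image of
  \<open>N 0\<close> is the full unit group, and the image of \<open>N (i + 1)\<close> is normalized by that of \<open>N i\<close>. For the
  last term this yields a non-unipotent element in the image of the unipotent group \<open>U\<close>.\<close>

lemma subnormal_unipotent_subset:
  assumes sub: "subnormal U (units_of R)" and uni: "unipotent_group R U"
  shows "U \<subseteq> \<one> <+ jacobson_radical R"
proof
  fix u assume u: "u \<in> U"
  interpret G: group "units_of R" by (rule units_group)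
  interpret GS: group "units_of S" by (rule hom.S.units_group)
  interpret units: group_hom "units_of R" "units_of S" h by (rule units_hom)
  obtain n :: nat and N where N0: "N 0 = carrier (units_of R)" and Nn: "N n = U"
    and N: "\<And>i. i < n \<Longrightarrow> N (Suc i) \<lhd> (units_of R)\<lparr>carrier := N i\<rparr>"
    using sub unfolding subnormal_def by blast
  have Nsub: "subgroup (N i) (units_of R)" if "i \<le> n" for i
    using G.subnormal_chain_subgroup[of N n i] N0 N that by blast
  have Nstep: "N (Suc i) \<subseteq> N i" "\<And>x k. x \<in> N i \<Longrightarrow> k \<in> N (Suc i) \<Longrightarrow> x \<otimes> k \<otimes> inv x \<in> N (Suc i)"
    if "i < n" for i
  proof -
    have Ni: "subgroup (N i) (units_of R)" using Nsub that by simp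
    note * = N[OF that, unfolded G.normal_in_subgroup_iff[OF Ni]]
    show "N (Suc i) \<subseteq> N i" using * by blast
    fix x k assume xk: "x \<in> N i" "k \<in> N (Suc i)"
    have "x \<in> Units R" using subgroup.subset[OF Ni] xk(1) by (auto simp: units_of_carrier)
    moreover have "x \<otimes>\<^bsub>units_of R\<^esub> k \<otimes>\<^bsub>units_of R\<^esub> inv\<^bsub>units_of R\<^esub> x \<in> N (Suc i)"
      using * xk by blast
    ultimately show "x \<otimes> k \<otimes> inv x \<in> N (Suc i)" by (simp add: units_of_mult units_of_inv)
  qed
  have UN: "u \<in> N i" if "i \<le> n" for i
    using that by (induction i rule: inc_induct) (use u Nn Nstep(1) in auto)
  have uR: "u \<in> Units R" using UN[of 0] N0 by (simp add: units_of_carrier)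
  have u_uni: "unipotent_elem R u" using uni u by (auto simp: unipotent_group_def)
  define a where "a = h u \<ominus>\<^bsub>S\<^esub> \<one>\<^bsub>S\<^esub>"
  have hu: "h u \<in> carrier S" using Units_closed[OF uR] by simp
  have a: "a \<in> carrier S" using hu by (simp add: a_def)
  have ua: "h u = \<one>\<^bsub>S\<^esub> \<oplus>\<^bsub>S\<^esub> a"
    using hu by (simp add: a_def hom.S.minus_eq hom.S.a_lcomm[of "\<one>\<^bsub>S\<^esub>" "h u"] hom.S.r_neg)
  have "h u = \<one>\<^bsub>S\<^esub>"
  proof (rule ccontr)
    assume "h u \<noteq> \<one>\<^bsub>S\<^esub>"
    then have an: "a \<noteq> \<zero>\<^bsub>S\<^esub>" using ua by auto
    have a_nil: "nilpotent_elem S a"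
    proof -
      obtain k :: nat where k: "(\<one>\<^bsub>S\<^esub> \<ominus>\<^bsub>S\<^esub> h u) [^]\<^bsub>S\<^esub> k = \<zero>\<^bsub>S\<^esub>"
        using hom_unipotent[OF u_uni] by (auto simp: unipotent_elem_def nilpotent_elem_def)
      have au: "a = (\<ominus>\<^bsub>S\<^esub> \<one>\<^bsub>S\<^esub>) \<otimes>\<^bsub>S\<^esub> (\<one>\<^bsub>S\<^esub> \<ominus>\<^bsub>S\<^esub> h u)"
        using hu by (simp add: a_def hom.S.minus_eq hom.S.l_minus hom.S.minus_add hom.S.a_comm)
      have "a [^]\<^bsub>S\<^esub> k = (\<ominus>\<^bsub>S\<^esub> \<one>\<^bsub>S\<^esub>) [^]\<^bsub>S\<^esub> k \<otimes>\<^bsub>S\<^esub> (\<one>\<^bsub>S\<^esub> \<ominus>\<^bsub>S\<^esub> h u) [^]\<^bsub>S\<^esub> k"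
        unfolding au using hu by (intro hom.S.pow_mult_distrib) (auto simp: hom.S.l_minus hom.S.r_minus)
      also have "\<dots> = \<zero>\<^bsub>S\<^esub>" unfolding k by simp
      finally show ?thesis using a by (auto simp: nilpotent_elem_def)
    qed
    have "\<exists>T \<subseteq> Units S. \<forall>K. subgroup K (units_of S) \<and> h u \<in> K \<and>
        (\<forall>t\<in>T. \<forall>k\<in>K. t \<otimes>\<^bsub>S\<^esub> k \<otimes>\<^bsub>S\<^esub> inv\<^bsub>S\<^esub> t \<in> K) \<longrightarrow>
        T \<subseteq> K \<and> (\<exists>w\<in>K. \<not> unipotent_elem S w)"
      unfolding ua using a an a_nil
      by (rule hom.S.non_unipotent_witness) (rule quotient_idempotent_multiple)
    then obtain T where T: "T \<subseteq> Units S"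
      and wit_all: "\<forall>K. subgroup K (units_of S) \<and> h u \<in> K \<and>
        (\<forall>t\<in>T. \<forall>k\<in>K. t \<otimes>\<^bsub>S\<^esub> k \<otimes>\<^bsub>S\<^esub> inv\<^bsub>S\<^esub> t \<in> K) \<longrightarrow>
        T \<subseteq> K \<and> (\<exists>w\<in>K. \<not> unipotent_elem S w)"
      by (elim exE conjE)
    have wit: "T \<subseteq> K \<and> (\<exists>w\<in>K. \<not> unipotent_elem S w)"
      if "subgroup K (units_of S)" "h u \<in> K"
        "\<And>t k. t \<in> T \<Longrightarrow> k \<in> K \<Longrightarrow> t \<otimes>\<^bsub>S\<^esub> k \<otimes>\<^bsub>S\<^esub> inv\<^bsub>S\<^esub> t \<in> K" for K
      by (rule wit_all[THEN spec, THEN mp]) (intro conjI ballI that)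
    have "T \<subseteq> h ` N i \<and> (\<exists>w \<in> h ` N i. \<not> unipotent_elem S w)" if "i \<le> n" for i
      using that
    proof (induction i)
      case 0
      have img: "h ` N 0 = Units S"
      proof -
        have "N 0 = Units R" by (simp only: N0 units_of_carrier)
        then show ?thesis using Units_lift by (auto intro: hom_Units)
      qed
      show ?case
      proof (rule wit)
        show "subgroup (h ` N 0) (units_of S)" using units.subgroup_img_is_subgroup[OF Nsub] by simp
        show "h u \<in> h ` N 0" using UN by simp
        show "t \<otimes>\<^bsub>S\<^esub> k \<otimes>\<^bsub>S\<^esub> inv\<^bsub>S\<^esub> t \<in> h ` N 0" if "t \<in> T" "k \<in> h ` N 0" for t k
        proof -
          have "t \<in> Units S" "k \<in> Units S" using that T unfolding img by blast+
          then show ?thesis unfolding img by (intro hom.S.Units_m_closed hom.S.Units_inv_Units)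
        qed
      qed
    next
      case (Suc i)
      then have IH: "T \<subseteq> h ` N i" and i: "i < n" by auto
      show ?case
      proof (rule wit)
        show "subgroup (h ` N (Suc i)) (units_of S)"
          using units.subgroup_img_is_subgroup[OF Nsub] Suc.prems by blast
        show "h u \<in> h ` N (Suc i)" using UN Suc.prems by blast
        fix t k assume "t \<in> T" "k \<in> h ` N (Suc i)"
        then obtain x y where x: "x \<in> N i" "t = h x" and y: "y \<in> N (Suc i)" "k = h y"
          using IH by blast
        have U: "x \<in> Units R" "y \<in> Units R"
          using subgroup.subset[OF Nsub[of i]] Nstep(1)[OF i] x y i by (auto simp: units_of_carrier)
        then have "t \<otimes>\<^bsub>S\<^esub> k \<otimes>\<^bsub>S\<^esub> inv\<^bsub>S\<^esub> t = h (x \<otimes> y \<otimes> inv x)"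
          using x y by (simp add: hom_inv Units_closed)
        then show "t \<otimes>\<^bsub>S\<^esub> k \<otimes>\<^bsub>S\<^esub> inv\<^bsub>S\<^esub> t \<in> h ` N (Suc i)" using Nstep(2)[OF i x(1) y(1)] by blast
      qed
    qed
    then obtain g where "g \<in> U" "\<not> unipotent_elem S (h g)" using Nn by blast
    then show False using hom_unipotent uni by (auto simp: unipotent_group_def)
  qed
  then show "u \<in> \<one> <+ jacobson_radical R" unfolding one_plus_jacobson_radical using uR by simp
qed

text \<open>On units, \<open>1 + J\<close> is the kernel of the homomorphism from the units of \<open>R\<close> to those of \<open>S\<close>.\<close>

lemma one_plus_jacobson_radical_unipotent_normal:
  assumes G: "subgroup G (units_of R)"
  shows "unipotent_normal_subgroup R G (G \<inter> (\<one> <+ jacobson_radical R))"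
proof -
  interpret G: group "units_of R" by (rule units_group)
  interpret units: group_hom "units_of R" "units_of S" h by (rule units_hom)
  let ?V = "\<one> <+ jacobson_radical R"
  have V: "?V = kernel (units_of R) (units_of S) h"
    unfolding one_plus_jacobson_radical kernel_def by (simp add: units_of_carrier units_of_one)
  have sub: "subgroup (G \<inter> ?V) (units_of R)"
    unfolding V using G units.subgroup_kernel by (rule G.subgroups_Inter_pair)
  have "x \<otimes>\<^bsub>units_of R\<^esub> u \<otimes>\<^bsub>units_of R\<^esub> inv\<^bsub>units_of R\<^esub> x \<in> G \<inter> ?V" if "x \<in> G" "u \<in> G \<inter> ?V" for x u
  proof -
    have "x \<in> carrier (units_of R)" using that subgroup.subset[OF G] by blast
    then have "x \<otimes>\<^bsub>units_of R\<^esub> u \<otimes>\<^bsub>units_of R\<^esub> inv\<^bsub>units_of R\<^esub> x \<in> ?V"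
      unfolding V using that normal.inv_op_closed2[OF units.normal_kernel] V by blast
    moreover have "x \<otimes>\<^bsub>units_of R\<^esub> u \<otimes>\<^bsub>units_of R\<^esub> inv\<^bsub>units_of R\<^esub> x \<in> G"
      using that subgroup.m_closed[OF G] subgroup.m_inv_closed[OF G] by blast
    ultimately show ?thesis by blast
  qed
  then have "G \<inter> ?V \<lhd> (units_of R)\<lparr>carrier := G\<rparr>"
    using sub unfolding G.normal_in_subgroup_iff[OF G] by blast
  moreover have "unipotent_elem R x" if "x \<in> ?V" for x
  proof -
    have "x \<in> carrier R" "\<one> \<ominus> x \<in> jacobson_radical R"
      using that hom_eq_one_iff unfolding one_plus_jacobson_radical by auto
    then show ?thesis using jacobson_radical_nil by (simp add: unipotent_elem_def)
  qed
  ultimately show ?thesis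
    using sub unfolding unipotent_normal_subgroup_def unipotent_group_def by blast
qed

lemma unipotent_radical_eq:
  assumes "subnormal G (units_of R)"
  shows "has_unipotent_radical R G \<and> unipotent_radical R G = G \<inter> (\<one> <+ jacobson_radical R)"
proof -
  interpret U: group "units_of R" by (rule units_group)
  let ?V = "G \<inter> (\<one> <+ jacobson_radical R)"
  have G: "subgroup G (units_of R)" using U.subnormal_imp_subgroup[OF assms] .
  have V: "unipotent_normal_subgroup R G ?V"
    using one_plus_jacobson_radical_unipotent_normal[OF G] .
  have greatest: "U \<subseteq> ?V" if "unipotent_normal_subgroup R G U" for U
  proof -
    have n: "U \<lhd> (units_of R)\<lparr>carrier := G\<rparr>" and "unipotent_group R U"
      using that by (auto simp: unipotent_normal_subgroup_def)
    then have "U \<subseteq> \<one> <+ jacobson_radical R"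
      using U.normal_in_subnormal[OF assms n] by (intro subnormal_unipotent_subset)
    moreover have "U \<subseteq> G" using n unfolding U.normal_in_subgroup_iff[OF G] by blast
    ultimately show ?thesis by blast
  qed
  have max_iff: "maximal_unipotent_normal_subgroup R G U \<longleftrightarrow> U = ?V" for U
  proof
    assume "maximal_unipotent_normal_subgroup R G U"
    then have U: "unipotent_normal_subgroup R G U"
      and max: "\<And>B. U \<subseteq> B \<Longrightarrow> unipotent_normal_subgroup R G B \<Longrightarrow> B = U"
      by (auto simp: maximal_unipotent_normal_subgroup_def maximal_def)
    show "U = ?V" using max[OF greatest[OF U] V] by (rule sym)
  next
    assume U: "U = ?V"
    show "maximal_unipotent_normal_subgroup R G U"
      unfolding U maximal_unipotent_normal_subgroup_def maximal_def
      using V greatest by (intro conjI allI impI equalityI) auto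
  qed
  show ?thesis
    unfolding has_unipotent_radical_def unipotent_radical_def max_iff
    by (intro conjI ex1I[of _ ?V] the_equality) (rule refl | assumption)+
qed

end

lemma (in strongly_pi_regular_ring) radical_quotient_exists:
  "radical_quotient R (R Quot jacobson_radical R) ((+>) (jacobson_radical R))"
proof -
  interpret J: ideal "jacobson_radical R" R by (rule jacobson_radical_ideal)
  show ?thesis
  proof (intro radical_quotient.intro radical_quotient_axioms.intro)
    show "strongly_pi_regular_ring R" by (rule strongly_pi_regular_ring_axioms)
    show "ring_hom_ring R (R Quot jacobson_radical R) ((+>) (jacobson_radical R))"
      by (rule J.rcos_ring_hom_ring)
    show "(+>) (jacobson_radical R) ` carrier R = carrier (R Quot jacobson_radical R)"
      unfolding FactRing_def A_RCOSETS_def' by (simp only: partial_object.simps) blast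
    fix x assume x: "x \<in> carrier R"
    have "jacobson_radical R +> x = jacobson_radical R \<longleftrightarrow> x \<in> jacobson_radical R"
    proof
      assume "jacobson_radical R +> x = jacobson_radical R"
      then show "x \<in> jacobson_radical R" using J.a_rcos_self[OF x] by (simp only:)
    qed (rule J.a_rcos_const)
    then show "jacobson_radical R +> x = \<zero>\<^bsub>R Quot jacobson_radical R\<^esub> \<longleftrightarrow> x \<in> jacobson_radical R"
      by (simp only: FactRing_def ring.simps)
  qed
qed

lemma (in strongly_pi_regular_ring) unipotent_radical_of_subnormal:
  assumes "subnormal G (units_of R)"
  shows "has_unipotent_radical R G \<and> unipotent_radical R G = G \<inter> (\<one> <+ jacobson_radical R)"
  using radical_quotient.unipotent_radical_eq[OF radical_quotient_exists assms] .

lemma (in strongly_pi_regular_ring) unipotent_radical_of_Units: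
  "has_unipotent_radical R (Units R) \<and> unipotent_radical R (Units R) = \<one> <+ jacobson_radical R"
proof -
  have "subnormal (Units R) (units_of R)"
    using group.subnormal_carrier[OF units_group] by (simp only: units_of_carrier)
  moreover have "Units R \<inter> (\<one> <+ jacobson_radical R) = \<one> <+ jacobson_radical R"
    unfolding radical_quotient.one_plus_jacobson_radical[OF radical_quotient_exists] by blast
  ultimately show ?thesis using unipotent_radical_of_subnormal[of "Units R"] by (simp only:)
qed

theorem theorem5p2:
  fixes F :: "('f, 'm) ring_scheme" and R :: "('f, 'r, 'n) module_scheme"
  assumes "finite_dimensional_algebra F R"
    and "infinite (carrier F) \<or> card (carrier F) \<ge> 4"
  shows "(\<forall>G. subnormal G (units_of R) \<longrightarrow>
            has_unipotent_radical R G \<and>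
            unipotent_radical R G = G \<inter> (\<one>\<^bsub>R\<^esub> <+\<^bsub>R\<^esub> jacobson_radical R)) \<and>
         has_unipotent_radical R (Units R) \<and>
         unipotent_radical R (Units R) = \<one>\<^bsub>R\<^esub> <+\<^bsub>R\<^esub> jacobson_radical R"
proof -
  interpret strongly_pi_regular_ring R
    using assms(1) by (rule finite_dimensional_algebra.strongly_pi_regular_ring)
  show ?thesis
    using unipotent_radical_of_subnormal unipotent_radical_of_Units by (intro conjI allI impI) simp_all
qed

end
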